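(* Let $\bm x(t)$ be the solution on $[0,T]$ of the replicator system $\frac{dx_i}{dt}=x_i\big(f_i(\bm x)-\sum_{j=1}^N x_jf_j(\bm x)\big)$, $i=1,\dots,N$, with $\bm x(0)\in\Delta^{N-1}$. Suppose that $f_1,\dots,f_N$ are twice continuously differentiable on the probability simplex $\Delta^{N-1}$. Then there exists a constant $C>0$, independent of the mesh, such that for every $M\in\mathbb{N}$ and every mesh $0=t_0<t_1<\dots<t_M=T$ with stepsizes $h_n=t_{n+1}-t_n>0$, $n=0,\dots,M-1$, the approximations $\{\bm x^n\}_{0\le n\le M}$ computed by the normalized rational integrator (defined in the context) satisfy $$\max_{n=0,\dots,M}\|\bm x(t_n)-\bm x^n\|\le C h^2,\qquad h=\max_{i=0,\dots,M-1}h_i,$$ i.e. the method is second-order convergent.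
   Context: $N\in\mathbb{N}$, $T>0$, and $\|\cdot\|$ is a norm on $\mathbb{R}^N$. The probability simplex is $\Delta^{N-1}=\{\bm\xi\in\mathbb{R}^N:\ \sum_{i=1}^N\xi_i=1,\ \xi_i\ge0\ \forall i\}$. A function is called $C^k$ on $\Delta^{N-1}$ if it is the restriction of a $C^k$ function defined on an open neighbourhood of $\Delta^{N-1}$ in $\mathbb{R}^N$. Let $F_i(\bm\xi)=f_i(\bm\xi)-\sum_{j=1}^N\xi_jf_j(\bm\xi)$ and $\rho(z)=\dfrac{z^2+6z+12}{z^2-6z+12}$, $z\in\mathbb{R}$. Normalized rational integrator: $\bm x^0=\bm x(0)$ and, for $n=0,\dots,M-1$ and $i=1,\dots,N$, $$x_i^{n+\frac12}=\frac{x_i^n\,\rho\!\left(\frac{h_n}{2}F_i(\bm x^n)\right)}{\sum_{j=1}^N x_j^n\,\rho\!\left(\frac{h_n}{2}F_j(\bm x^n)\right)},\qquad x_i^{n+1}=\frac{x_i^n\,\rho\!\left(h_nF_i(\bm x^{n+\frac12})\right)}{\sum_{j=1}^N x_j^n\,\rho\!\left(h_nF_j(\bm x^{n+\frac12})\right)}.$$ *)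

theory Defs
  imports "HOL-Analysis.Analysis"
begin

definition is_norm :: "('a::real_vector \<Rightarrow> real) \<Rightarrow> bool" where
  "is_norm \<nu> \<longleftrightarrow>
     (\<forall>v. 0 \<le> \<nu> v) \<and> (\<forall>v. \<nu> v = 0 \<longleftrightarrow> v = 0) \<and>
     (\<forall>c v. \<nu> (c *\<^sub>R v) = \<bar>c\<bar> * \<nu> v) \<and>
     (\<forall>v w. \<nu> (v + w) \<le> \<nu> v + \<nu> w)"

definition prob_simplex :: "(real^'n) set" where
  "prob_simplex = {\<xi>. (\<Sum>i\<in>UNIV. \<xi> $ i) = 1 \<and> (\<forall>i. 0 \<le> \<xi> $ i)}"

text \<open>\<open>Ck_on k g U\<close> is meant for open \<open>U\<close>: the derivatives are two-sided ones, and the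
  directional derivatives along basis vectors are the partial derivatives.\<close>

primrec Ck_on :: "nat \<Rightarrow> ('a::euclidean_space \<Rightarrow> real) \<Rightarrow> 'a set \<Rightarrow> bool" where
  "Ck_on 0 g U \<longleftrightarrow> continuous_on U g"
| "Ck_on (Suc k) g U \<longleftrightarrow>
     (\<forall>x\<in>U. g differentiable (at x)) \<and>
     (\<forall>b\<in>Basis. Ck_on k (\<lambda>x. frechet_derivative g (at x) b) U)"

text \<open>A function \<open>f\<close> is \<open>C\<^sup>k\<close> on the simplex iff \<open>Ck_simplex_extension k f g\<close> for some
  \<open>g\<close>. Only the values of \<open>f\<close> on the simplex matter; a total function \<open>f\<close> may be
  arbitrary elsewhere. Likewise \<open>g\<close> matters only on some neighbourhood of the simplex.
  The theorem poses the differential equation with such a \<open>g\<close>, so that it need not presuppose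
  that the solution stays in the simplex.\<close>

definition Ck_simplex_extension ::
    "nat \<Rightarrow> (real^'n \<Rightarrow> real) \<Rightarrow> (real^'n \<Rightarrow> real) \<Rightarrow> bool" where
  "Ck_simplex_extension k f g \<longleftrightarrow>
     (\<exists>U. open U \<and> prob_simplex \<subseteq> U \<and> Ck_on k g U) \<and> (\<forall>\<xi>\<in>prob_simplex. f \<xi> = g \<xi>)"

definition replicator_F :: "('n \<Rightarrow> real^'n \<Rightarrow> real) \<Rightarrow> 'n::finite \<Rightarrow> real^'n \<Rightarrow> real" where
  "replicator_F f i \<xi> = f i \<xi> - (\<Sum>j\<in>UNIV. \<xi> $ j * f j \<xi>)"

definition replicator_solution ::
    "('n::finite \<Rightarrow> real^'n \<Rightarrow> real) \<Rightarrow> real \<Rightarrow> (real \<Rightarrow> real^'n) \<Rightarrow> bool" where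
  "replicator_solution f T x \<longleftrightarrow>
     (\<forall>t\<in>{0..T}. \<forall>i. ((\<lambda>s. x s $ i) has_real_derivative
        x t $ i * (f i (x t) - (\<Sum>j\<in>UNIV. x t $ j * f j (x t)))) (at t within {0..T}))"

definition \<rho> :: "real \<Rightarrow> real" where
  "\<rho> z = (z\<^sup>2 + 6 * z + 12) / (z\<^sup>2 - 6 * z + 12)"

text \<open>Both stages of the integrator advance \<open>x\<close> by a step of size \<open>\<tau>\<close>, with \<open>F\<close> evaluated at \<open>y\<close>.\<close>

definition nri_stage ::
    "('n::finite \<Rightarrow> real^'n \<Rightarrow> real) \<Rightarrow> real \<Rightarrow> real^'n \<Rightarrow> real^'n \<Rightarrow> real^'n" where
  "nri_stage f \<tau> x y =
     (\<chi> i. x $ i * \<rho> (\<tau> * replicator_F f i y) /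
           (\<Sum>j\<in>UNIV. x $ j * \<rho> (\<tau> * replicator_F f j y)))"

definition nri_step ::
    "('n::finite \<Rightarrow> real^'n \<Rightarrow> real) \<Rightarrow> real \<Rightarrow> real^'n \<Rightarrow> real^'n" where
  "nri_step f h x = nri_stage f h x (nri_stage f (h / 2) x x)"

primrec nri ::
    "('n::finite \<Rightarrow> real^'n \<Rightarrow> real) \<Rightarrow> (nat \<Rightarrow> real) \<Rightarrow> real^'n \<Rightarrow> nat \<Rightarrow> real^'n" where
  "nri f h x0 0 = x0"
| "nri f h x0 (Suc n) = nri_step f (h n) (nri f h x0 n)"

definition is_mesh :: "real \<Rightarrow> nat \<Rightarrow> (nat \<Rightarrow> real) \<Rightarrow> bool" where
  "is_mesh T M t \<longleftrightarrow> t 0 = 0 \<and> t M = T \<and> (\<forall>n<M. t n < t (Suc n))"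

definition stepsize :: "(nat \<Rightarrow> real) \<Rightarrow> nat \<Rightarrow> real" where
  "stepsize t n = t (Suc n) - t n"

end

theory Submission
  imports Defs
begin

text \<open>
  Every component of the solution satisfies \<open>x\<^sub>i' = x\<^sub>i F\<^sub>i (x)\<close>, that is
  \<open>x\<^sub>i (t + h) = x\<^sub>i (t) exp (\<integral> F\<^sub>i (x))\<close> with the integral over \<open>{t..t + h}\<close>. The integrator is
  this formula with three changes: \<open>\<rho>\<close> replaces \<open>exp\<close>, a quadrature replaces the integral, and
  the result is normalized. The half step uses the rectangle rule and has error \<open>O(h\<^sup>2)\<close>. The full
  step uses the midpoint rule with the half step as approximate midpoint; the exponent then has
  error \<open>O(h\<^sup>3) + h O(h\<^sup>2)\<close>. Since \<open>\<rho>\<close> agrees with \<open>exp\<close> to this order and normalization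
  at most doubles an error (\<open>nri_stage_error\<close>), the local error is \<open>O(h\<^sup>3)\<close>
  (\<open>nri_local_error\<close>). Working with the factors \<open>exp (\<integral> F\<^sub>i (x))\<close> instead of Taylor expansions of
  \<open>x\<close> and of the numerical step spares the second-order expansion of the normalized quotient.

  The quadrature estimates need \<open>F\<^sub>i (x (t))\<close> to be \<open>C\<^sup>2\<close> in \<open>t\<close> (\<open>replicator_solution_Ck\<close>), and all
  constants are taken on the compact simplex. The solution stays there because its components and
  the defect of their sum from \<open>1\<close> satisfy linear equations
  (\<open>replicator_solution_in_simplex\<close>), the numerical approximations because the weights \<open>\<rho>\<close> are
  positive and the result is normalized (\<open>nri_in_simplex\<close>).

  For stability the step is written as \<open>\<xi> + h \<Phi>(h, \<xi>)\<close>, where \<open>\<Phi>\<close> is Lipschitz in \<open>\<xi>\<close> on the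
  simplex uniformly in \<open>h\<close>. Here \<open>\<rho> \<ge> 1/14\<close> keeps the normalizing sums away from \<open>0\<close> for all
  step sizes (\<open>nri_step_stable\<close>). A discrete Gronwall argument (\<open>accumulated_error\<close>) turns local
  error and stability into the global bound \<open>O(h\<^sup>2)\<close>, first for the Euclidean norm and, as every
  other norm is bounded by a multiple of it, for the given one.
\<close>

section \<open>The simplex\<close>

lemma prob_simplexD:
  assumes "\<xi> \<in> prob_simplex"
  shows "(\<Sum>i\<in>UNIV. \<xi> $ i) = 1" "0 \<le> \<xi> $ i" "\<xi> $ i \<le> 1"
proof -
  show sum: "(\<Sum>i\<in>UNIV. \<xi> $ i) = 1" and nn: "0 \<le> \<xi> $ i"
    using assms by (auto simp: prob_simplex_def)
  show "\<xi> $ i \<le> 1"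
    using member_le_sum[of i UNIV "\<lambda>i. \<xi> $ i"] assms sum by (auto simp: prob_simplex_def)
qed

lemma convex_prob_simplex: "convex (prob_simplex :: (real^'n::finite) set)"
  by (rule convexI)
    (auto simp: prob_simplex_def sum.distrib sum_distrib_left[symmetric])

lemma closed_prob_simplex: "closed (prob_simplex :: (real^'n::finite) set)"
proof -
  have eq: "(prob_simplex :: (real^'n) set)
      = {\<xi>. (\<Sum>i\<in>UNIV. \<xi> $ i) = 1} \<inter> (\<Inter>i. {\<xi>. 0 \<le> \<xi> $ i})"
    by (auto simp: prob_simplex_def)
  show ?thesis
    unfolding eq
    by (intro closed_Int closed_INT ballI closed_Collect_eq closed_Collect_le continuous_intros)
qed

lemma compact_prob_simplex: "compact (prob_simplex :: (real^'n::finite) set)"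
proof -
  have "norm \<xi> \<le> 1" if "\<xi> \<in> prob_simplex" for \<xi> :: "real^'n"
    using norm_le_l1_cart[of \<xi>] prob_simplexD[OF that] by simp
  then show ?thesis
    by (auto simp: compact_eq_bounded_closed closed_prob_simplex bounded_iff)
qed

section \<open>Functions of class \<open>C\<^sup>k\<close> on the simplex and along a curve\<close>

lemma Ck_on_subset: "Ck_on k g U \<Longrightarrow> V \<subseteq> U \<Longrightarrow> Ck_on k g V"
  by (induction k arbitrary: g) (auto intro: continuous_on_subset)

lemma Ck_on_SucD: "Ck_on (Suc k) g U \<Longrightarrow> Ck_on k g U"
proof (induction k arbitrary: g)
  case 0
  then show ?case
    by (auto intro: continuous_at_imp_continuous_on differentiable_imp_continuous_within)
next
  case (Suc k)
  then show ?case by (metis Ck_on.simps(2))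
qed

text \<open>A derivative is supplied as a witness, so that for a set without isolated points this is the
  usual class \<open>C\<^sup>k\<close>, with one-sided derivatives at the end points of an interval.\<close>

primrec Ck_curve :: "nat \<Rightarrow> real set \<Rightarrow> (real \<Rightarrow> real) \<Rightarrow> bool" where
  "Ck_curve 0 S u \<longleftrightarrow> continuous_on S u"
| "Ck_curve (Suc k) S u \<longleftrightarrow>
     (\<exists>u'. (\<forall>t\<in>S. (u has_real_derivative u' t) (at t within S)) \<and> Ck_curve k S u')"

lemma Ck_curve_SucD: "Ck_curve (Suc k) S u \<Longrightarrow> Ck_curve k S u"
proof (induction k arbitrary: u)
  case 0
  then show ?case by (auto intro: DERIV_continuous_on)
next
  case (Suc k)
  then show ?case by (metis Ck_curve.simps(2))
qed

lemma Ck_curve_cong: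
  assumes "Ck_curve k S u" "\<And>t. t \<in> S \<Longrightarrow> v t = u t"
  shows "Ck_curve k S v"
proof (cases k)
  case 0
  then show ?thesis using assms continuous_on_cong[of S S v u] by simp
next
  case (Suc m)
  have "(v has_real_derivative d) (at t within S)"
    if "(u has_real_derivative d) (at t within S)" "t \<in> S" for t d
    using has_derivative_transform[of t S v u] assms(2) that by (simp add: has_field_derivative_def)
  then show ?thesis using assms(1) Suc by auto
qed

lemma Ck_curve_const: "Ck_curve k S (\<lambda>_. c)"
proof (induction k arbitrary: c)
  case (Suc k)
  then show ?case by (auto intro!: exI[of _ "\<lambda>_. 0"] derivative_eq_intros)
qed auto

lemma Ck_curve_add: "Ck_curve k S u \<Longrightarrow> Ck_curve k S v \<Longrightarrow> Ck_curve k S (\<lambda>t. u t + v t)"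
proof (induction k arbitrary: u v)
  case (Suc k)
  then obtain u' v' where
    "\<forall>t\<in>S. (u has_real_derivative u' t) (at t within S)" "Ck_curve k S u'"
    "\<forall>t\<in>S. (v has_real_derivative v' t) (at t within S)" "Ck_curve k S v'"
    by auto
  then show ?case
    using Suc.IH by (auto intro!: exI[of _ "\<lambda>t. u' t + v' t"] derivative_intros)
qed (auto intro: continuous_intros)

lemma Ck_curve_mult: "Ck_curve k S u \<Longrightarrow> Ck_curve k S v \<Longrightarrow> Ck_curve k S (\<lambda>t. u t * v t)"
proof (induction k arbitrary: u v)
  case (Suc k)
  then obtain u' v' where
    d: "\<forall>t\<in>S. (u has_real_derivative u' t) (at t within S)" "Ck_curve k S u'"
    "\<forall>t\<in>S. (v has_real_derivative v' t) (at t within S)" "Ck_curve k S v'"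
    by auto
  have "Ck_curve k S (\<lambda>t. u' t * v t + u t * v' t)"
    using d Ck_curve_SucD[OF Suc.prems(1)] Ck_curve_SucD[OF Suc.prems(2)]
    by (intro Ck_curve_add Suc.IH)
  then show ?case
    using d by (auto intro!: exI[of _ "\<lambda>t. u' t * v t + u t * v' t"] derivative_eq_intros)
qed (auto intro: continuous_intros)

lemma Ck_curve_diff:
  assumes "Ck_curve k S u" "Ck_curve k S v"
  shows "Ck_curve k S (\<lambda>t. u t - v t)"
  using Ck_curve_add[OF assms(1) Ck_curve_mult[OF Ck_curve_const[of k S "-1"] assms(2)]] by simp

lemma Ck_curve_sum:
  "finite I \<Longrightarrow> (\<And>i. i \<in> I \<Longrightarrow> Ck_curve k S (u i)) \<Longrightarrow> Ck_curve k S (\<lambda>t. \<Sum>i\<in>I. u i t)"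
  by (induction rule: finite_induct) (simp_all add: Ck_curve_add Ck_curve_const)

text \<open>By the chain rule the derivative of \<open>G \<circ> x\<close> is the sum of the products of
  \<open>\<partial>\<^sub>b G \<circ> x\<close> with the components of the velocity; both factors have one derivative fewer, so
  induction on \<open>k\<close> applies.\<close>

lemma Ck_curve_compose:
  fixes x :: "real \<Rightarrow> 'a::euclidean_space"
  assumes "Ck_on k G U" "\<And>b. b \<in> Basis \<Longrightarrow> Ck_curve k S (\<lambda>t. x t \<bullet> b)" "x ` S \<subseteq> U"
  shows "Ck_curve k S (\<lambda>t. G (x t))"
  using assms(1,2)
proof (induction k arbitrary: G)
  case 0
  then have "continuous_on S x"
    unfolding continuous_on_componentwise[of S x] by simp
  then show ?case
    using 0 assms(3) by (auto intro: continuous_on_compose2)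
next
  case (Suc k)
  obtain v where v: "\<And>b t. b \<in> Basis \<Longrightarrow> t \<in> S \<Longrightarrow>
      ((\<lambda>t. x t \<bullet> b) has_real_derivative v b t) (at t within S)"
    and vk: "\<And>b. b \<in> Basis \<Longrightarrow> Ck_curve k S (v b)"
    using Suc.prems(2) by simp metis
  define V where "V t = (\<Sum>b\<in>Basis. v b t *\<^sub>R b)" for t
  have dx: "(x has_derivative (\<lambda>h. h *\<^sub>R V t)) (at t within S)" if "t \<in> S" for t
    unfolding has_derivative_componentwise_within[of x]
  proof
    fix b :: 'a assume "b \<in> Basis"
    then have "(\<lambda>h. (h *\<^sub>R V t) \<bullet> b) = (*) (v b t)"
      by (simp add: V_def inner_sum_left inner_Basis mult.commute fun_eq_iff
          if_distrib[of "\<lambda>x. _ * x"] sum.delta cong: if_cong)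
    then show "((\<lambda>t. x t \<bullet> b) has_derivative (\<lambda>h. (h *\<^sub>R V t) \<bullet> b)) (at t within S)"
      using v[OF \<open>b \<in> Basis\<close> that] by (simp add: has_field_derivative_def)
  qed
  let ?D = "\<lambda>t. frechet_derivative G (at (x t))"
  have "((\<lambda>t. G (x t)) has_real_derivative (\<Sum>b\<in>Basis. v b t * ?D t b)) (at t within S)"
    if "t \<in> S" for t
  proof -
    have dG: "(G has_derivative ?D t) (at (x t))"
      using Suc.prems(1) assms(3) that by (auto simp: frechet_derivative_works[symmetric])
    have lin: "linear (?D t)" using dG by (rule has_derivative_linear)
    have "((\<lambda>t. G (x t)) has_derivative (\<lambda>h. ?D t (h *\<^sub>R V t))) (at t within S)"
      using dx[OF that] dG by (rule has_derivative_compose)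
    moreover have "?D t (h *\<^sub>R V t) = (\<Sum>b\<in>Basis. v b t * ?D t b) * h" for h
      by (simp add: linear_cmul[OF lin] V_def linear_sum[OF lin] mult.commute)
    ultimately show ?thesis
      by (simp add: has_field_derivative_def)
  qed
  moreover have "Ck_curve k S (\<lambda>t. \<Sum>b\<in>Basis. v b t * ?D t b)"
    using Suc.prems Suc.IH[where G = "\<lambda>x. frechet_derivative G (at x) b" for b] vk Ck_curve_SucD
    by (intro Ck_curve_sum Ck_curve_mult) auto
  ultimately show ?case
    by (auto intro!: exI[of _ "\<lambda>t. \<Sum>b\<in>Basis. v b t * ?D t b"])
qed

text \<open>The gradient is bounded on a compact set, and a segment between two points of a convex set
  stays inside it.\<close>

lemma Ck_on_imp_Lipschitz:
  fixes g :: "'a::euclidean_space \<Rightarrow> real"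
  assumes "Ck_on 1 g U" "S \<subseteq> U" "compact S" "convex S"
  shows "\<exists>L\<ge>0. \<forall>x\<in>S. \<forall>y\<in>S. \<bar>g x - g y\<bar> \<le> L * norm (x - y)"
proof -
  let ?D = "\<lambda>z. frechet_derivative g (at z)"
  have "\<exists>B. \<forall>z\<in>S. \<bar>?D z b\<bar> \<le> B" if "b \<in> Basis" for b
  proof -
    have "continuous_on S (\<lambda>z. ?D z b)"
      using assms(1,2) that by (auto intro: continuous_on_subset)
    then have "bounded ((\<lambda>z. ?D z b) ` S)"
      using assms(3) by (intro compact_imp_bounded compact_continuous_image)
    then show ?thesis by (auto simp: bounded_iff)
  qed
  then obtain B where B: "\<And>b z. b \<in> Basis \<Longrightarrow> z \<in> S \<Longrightarrow> \<bar>?D z b\<bar> \<le> B b"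
    by metis
  then have B': "\<bar>?D z b\<bar> \<le> \<bar>B b\<bar>" if "b \<in> Basis" "z \<in> S" for b z
    using that order.trans[OF _ abs_ge_self] by blast
  have dg: "(g has_derivative ?D z) (at z)" if "z \<in> S" for z
    using assms(1,2) that by (auto simp: frechet_derivative_works[symmetric])
  have on: "onorm (?D z) \<le> (\<Sum>b\<in>Basis. \<bar>B b\<bar>)" if "z \<in> S" for z
  proof (rule onorm_le)
    fix w
    have lin: "linear (?D z)" using dg[OF that] by (rule has_derivative_linear)
    have "?D z w = ?D z (\<Sum>b\<in>Basis. (w \<bullet> b) *\<^sub>R b)"
      by (simp add: euclidean_representation)
    also have "\<dots> = (\<Sum>b\<in>Basis. (w \<bullet> b) * ?D z b)"
      by (simp add: linear_sum[OF lin] linear_cmul[OF lin])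
    also have "\<bar>\<dots>\<bar> \<le> (\<Sum>b\<in>Basis. norm w * \<bar>B b\<bar>)"
      using B'[OF _ that] Basis_le_norm[of _ w]
      by (intro order.trans[OF sum_abs] sum_mono) (auto simp: abs_mult intro!: mult_mono)
    finally show "norm (?D z w) \<le> (\<Sum>b\<in>Basis. \<bar>B b\<bar>) * norm w"
      by (simp add: sum_distrib_left mult.commute)
  qed
  have "\<bar>g x - g y\<bar> \<le> (\<Sum>b\<in>Basis. \<bar>B b\<bar>) * norm (x - y)" if "x \<in> S" "y \<in> S" for x y
    using differentiable_bound[OF assms(4) has_derivative_at_withinI[OF dg] on that] by simp
  then show ?thesis
    by (intro exI[of _ "\<Sum>b\<in>Basis. \<bar>B b\<bar>"]) (auto intro: sum_nonneg)
qed

section \<open>The exact solution\<close>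

lemma linear_ode_solution:
  assumes "convex S"
    and "\<And>s. s \<in> S \<Longrightarrow> (u has_real_derivative u s * G s) (at s within S)"
    and "\<And>s. s \<in> S \<Longrightarrow> (A has_real_derivative G s) (at s within S)"
    and "r \<in> S" "s \<in> S"
  shows "u s = u r * exp (A s - A r)"
proof -
  have "((\<lambda>s. u s * exp (- A s)) has_real_derivative 0) (at s within S)" if "s \<in> S" for s
    by (rule derivative_eq_intros assms(2,3)[OF that] | simp add: algebra_simps)+
  then obtain c where c: "\<And>s. s \<in> S \<Longrightarrow> u s * exp (- A s) = c"
    using has_field_derivative_zero_constant[OF assms(1), of "\<lambda>s. u s * exp (- A s)"] by blast
  have "u s = c * exp (A s)" if "s \<in> S" for s
    using c[OF that] by (auto simp: exp_minus field_simps)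
  then show ?thesis
    using assms(4,5) by (simp add: exp_diff)
qed

text \<open>As long as the curve stays where \<open>g\<close> is continuous, each component solves a linear equation
  \<open>u' = u G\<close> and keeps its sign, and \<open>\<Sigma>\<^sub>i x\<^sub>i - 1\<close> solves \<open>u' = - u \<phi>\<close> with
  \<open>\<phi> = \<Sigma>\<^sub>j x\<^sub>j g\<^sub>j (x)\<close> and initial value \<open>0\<close>.\<close>

lemma replicator_stays_locally:
  fixes x :: "real \<Rightarrow> real^'n::finite"
  assumes der: "\<And>t i. t \<in> {c..d} \<Longrightarrow> ((\<lambda>s. x s $ i) has_real_derivative
        x t $ i * (g i (x t) - (\<Sum>j\<in>UNIV. x t $ j * g j (x t)))) (at t within {c..d})"
    and cont: "\<And>i. continuous_on U (g i)" and U: "x ` {c..d} \<subseteq> U"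
    and c: "x c \<in> prob_simplex" and t: "t \<in> {c..d}"
  shows "x t \<in> prob_simplex"
proof -
  have cx: "continuous_on {c..d} (\<lambda>s. x s $ i)" for i
    using der by (rule DERIV_continuous_on)
  then have "continuous_on {c..d} (\<lambda>s. \<chi> i. x s $ i)"
    by (rule continuous_on_vec_lambda)
  then have "continuous_on {c..d} x" by simp
  then have cg: "continuous_on {c..d} (\<lambda>s. g i (x s))" for i
    using continuous_on_compose2[OF cont _ U] by blast
  define \<phi> where "\<phi> s = (\<Sum>j\<in>UNIV. x s $ j * g j (x s))" for s
  have c\<phi>: "continuous_on {c..d} \<phi>"
    unfolding \<phi>_def by (intro continuous_intros cx cg)
  have cG: "continuous_on {c..d} (\<lambda>s. g i (x s) - \<phi> s)" for i
    by (intro continuous_intros cg c\<phi>)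
  have ct: "c \<in> {c..d}" using t by auto
  have "0 \<le> x t $ i" for i
    using linear_ode_solution[OF _ der[of _ i, folded \<phi>_def]
        integral_has_real_derivative[OF cG[of i]] ct t] prob_simplexD(2)[OF c, of i]
    by simp
  moreover have "(\<Sum>i\<in>UNIV. x t $ i) - 1 = 0"
  proof -
    have d: "((\<lambda>s. (\<Sum>i\<in>UNIV. x s $ i) - 1) has_real_derivative
        ((\<Sum>i\<in>UNIV. x s $ i) - 1) * - \<phi> s) (at s within {c..d})" if "s \<in> {c..d}" for s
    proof -
      have "(\<Sum>i\<in>UNIV. x s $ i * (g i (x s) - \<phi> s)) - 0 = ((\<Sum>i\<in>UNIV. x s $ i) - 1) * - \<phi> s"
        by (simp add: right_diff_distrib sum_subtractf flip: \<phi>_def sum_distrib_right)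
          (simp add: algebra_simps)
      moreover have "((\<lambda>s. (\<Sum>i\<in>UNIV. x s $ i) - 1) has_real_derivative
        (\<Sum>i\<in>UNIV. x s $ i * (g i (x s) - \<phi> s)) - 0) (at s within {c..d})"
        by (intro DERIV_diff DERIV_sum der[OF that, folded \<phi>_def] DERIV_const)
      ultimately show ?thesis by simp
    qed
    show ?thesis
      using linear_ode_solution[OF _ d integral_has_real_derivative[OF continuous_on_minus[OF c\<phi>]]
          ct t] prob_simplexD(1)[OF c]
      by simp
  qed
  ultimately show ?thesis
    by (auto simp: prob_simplex_def)
qed

text \<open>Nothing is known about the field outside \<open>U\<close>, so the local result is propagated from the
  infimum \<open>c\<close> of the times at which the curve is outside the simplex: by closedness \<open>x c\<close> is still
  inside, hence the curve is in \<open>U\<close> for a while after \<open>c\<close>.\<close>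

lemma replicator_solution_in_simplex:
  fixes x :: "real \<Rightarrow> real^'n::finite"
  assumes sol: "replicator_solution g T x" and x0: "x 0 \<in> prob_simplex"
    and U: "open U" "prob_simplex \<subseteq> U" "\<And>i. continuous_on U (g i)"
    and s: "s \<in> {0..T}"
  shows "x s \<in> prob_simplex"
proof (rule ccontr)
  assume out: "x s \<notin> prob_simplex"
  define B where "B = {t\<in>{0..T}. x t \<notin> prob_simplex}"
  define c where "c = Inf B"
  have "s \<in> B" using out s by (simp add: B_def)
  then have B: "B \<noteq> {}" "bdd_below B"
    by (auto simp: B_def intro: bdd_belowI[of _ 0])
  have c: "c \<in> {0..T}"
    using cInf_lower[OF \<open>s \<in> B\<close> B(2)] cInf_greatest[OF B(1), of 0] s
    by (auto simp: c_def B_def)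
  have before: "x t \<in> prob_simplex" if "0 \<le> t" "t < c" for t
  proof (rule ccontr)
    assume "x t \<notin> prob_simplex"
    then have "t \<in> B" using that c by (simp add: B_def)
    then have "c \<le> t" unfolding c_def using B(2) by (rule cInf_lower)
    then show False using that by simp
  qed
  have der: "((\<lambda>s. x s $ i) has_real_derivative
        x t $ i * (g i (x t) - (\<Sum>j\<in>UNIV. x t $ j * g j (x t)))) (at t within {0..T})"
    if "t \<in> {0..T}" for t i
    using sol that by (simp add: replicator_solution_def)
  have "continuous_on {0..T} (\<lambda>s. x s $ i)" for i
    using der by (rule DERIV_continuous_on)
  then have "continuous_on {0..T} (\<lambda>s. \<chi> i. x s $ i)"
    by (rule continuous_on_vec_lambda)
  then have cx: "continuous_on {0..T} x" by simp
  have xc: "x c \<in> prob_simplex"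
  proof (cases "c = 0")
    case False
    then have "0 < c" using c by simp
    have "closure {0..<c} = {0..c}" using \<open>0 < c\<close> by simp
    moreover have "continuous_on {0..c} x"
      using cx c by (auto intro: continuous_on_subset)
    moreover have "x ` {0..<c} \<subseteq> prob_simplex"
      using before by auto
    ultimately have "x ` {0..c} \<subseteq> prob_simplex"
      using image_closure_subset[of "{0..<c}" x prob_simplex] closed_prob_simplex by simp
    then show ?thesis using \<open>0 < c\<close> by auto
  qed (use x0 in simp)
  obtain e where e: "e > 0" "ball (x c) e \<subseteq> U"
    using U xc open_contains_ball by blast
  obtain \<delta> where \<delta>: "\<delta> > 0" "\<And>t. t \<in> {0..T} \<Longrightarrow> dist t c < \<delta> \<Longrightarrow> dist (x t) (x c) < e"
    using cx c e(1) unfolding continuous_on_iff by metis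
  define d where "d = min T (c + \<delta> / 2)"
  have inU: "x ` {c..d} \<subseteq> U"
  proof (rule image_subsetI)
    fix t assume "t \<in> {c..d}"
    then have "t \<in> {0..T}" "dist t c < \<delta>"
      using c \<delta>(1) by (auto simp: d_def dist_real_def)
    then have "dist (x t) (x c) < e" by (rule \<delta>(2))
    then have "x t \<in> ball (x c) e" by (simp add: dist_commute)
    then show "x t \<in> U" using e(2) by blast
  qed
  have inside: "x t \<in> prob_simplex" if "t \<in> {c..d}" for t
  proof (rule replicator_stays_locally[OF _ U(3) inU xc that])
    fix t i assume "t \<in> {c..d}"
    then show "((\<lambda>s. x s $ i) has_real_derivative
        x t $ i * (g i (x t) - (\<Sum>j\<in>UNIV. x t $ j * g j (x t)))) (at t within {c..d})"
      using c by (intro has_field_derivative_subset[OF der]) (auto simp: d_def)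
  qed
  have "d < b" if "b \<in> B" for b
  proof (rule ccontr)
    assume "\<not> d < b"
    moreover have "0 \<le> b" "x b \<notin> prob_simplex" using that by (auto simp: B_def)
    ultimately show False
      using before[of b] inside[of b] by (cases "b < c") auto
  qed
  then have "d < s" "d \<le> c"
    using \<open>s \<in> B\<close> cInf_greatest[OF B(1), of d] by (auto simp: c_def intro: less_imp_le)
  then show False
    using \<delta>(1) c s by (auto simp: d_def)
qed

text \<open>The right-hand side of the differential equation is \<open>C\<^sup>k\<close> along \<open>x\<close> once \<open>x\<close> is, so \<open>x\<close>
  gains one derivative at each step of the induction.\<close>

lemma replicator_solution_Ck:
  fixes x :: "real \<Rightarrow> real^'n::finite"
  assumes sol: "replicator_solution g T x" and U: "x ` {0..T} \<subseteq> U"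
    and g: "\<And>i. Ck_on k (g i) U"
  shows "Ck_curve k {0..T} (\<lambda>t. replicator_F g i (x t))"
proof -
  have comp: "Ck_curve m {0..T} (\<lambda>t. g i (x t))"
    if "Ck_on m (g i) U" "\<And>i. Ck_curve m {0..T} (\<lambda>t. x t $ i)" for m i
    using that(1) _ U
  proof (rule Ck_curve_compose)
    fix b :: "real^'n" assume "b \<in> Basis"
    then show "Ck_curve m {0..T} (\<lambda>t. x t \<bullet> b)"
      using that(2) by (auto simp: Basis_vec_def inner_axis)
  qed
  have F: "Ck_curve m {0..T} (\<lambda>t. replicator_F g i (x t))"
    if "\<And>i. Ck_on m (g i) U" "\<And>i. Ck_curve m {0..T} (\<lambda>t. x t $ i)" for m i
    unfolding replicator_F_def
    by (intro Ck_curve_diff Ck_curve_sum Ck_curve_mult comp that) simp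
  have "Ck_curve k {0..T} (\<lambda>t. x t $ i)" for i
    using g
  proof (induction k arbitrary: i)
    case 0
    have "continuous_on {0..T} (\<lambda>t. x t $ i)"
      using sol unfolding replicator_solution_def by (intro DERIV_continuous_on) blast
    then show ?case by simp
  next
    case (Suc k)
    have k: "Ck_on k (g i) U" for i
      using Suc.prems by (rule Ck_on_SucD)
    have "Ck_curve k {0..T} (\<lambda>t. x t $ i * replicator_F g i (x t))"
      by (intro Ck_curve_mult F Suc.IH k)
    then show ?case
      using sol by (auto simp: replicator_solution_def replicator_F_def
          intro!: exI[of _ "\<lambda>t. x t $ i * replicator_F g i (x t)"])
  qed
  then show ?thesis
    by (intro F g)
qed

section \<open>The rational function \<open>\<rho>\<close> as an approximation of the exponential\<close>

lemma rho_denominator: "z\<^sup>2 - 6 * z + 12 \<ge> (3::real)"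
proof -
  have "z\<^sup>2 - 6 * z + 12 = (z - 3)\<^sup>2 + 3"
    by (simp add: power2_eq_square algebra_simps)
  then show ?thesis by simp
qed

lemma rho_ge: "\<rho> z \<ge> 1 / 14"
proof -
  (* 13 z^2 + 90 z + 156 has discriminant 8100 - 8112 < 0 *)
  have "14 * (z\<^sup>2 + 6 * z + 12) - (z\<^sup>2 - 6 * z + 12) = 13 * (z + 45 / 13)\<^sup>2 + 3 / 13"
    by (simp add: power2_eq_square field_simps)
  then have "14 * (z\<^sup>2 + 6 * z + 12) \<ge> z\<^sup>2 - 6 * z + 12"
    using zero_le_power2[of "z + 45 / 13"] by linarith
  then show ?thesis
    using rho_denominator[of z] by (simp add: \<rho>_def field_simps)
qed

lemma rho_pos: "\<rho> z > 0"
  using rho_ge[of z] by linarith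

lemma rho_eq: "\<rho> z = 1 + z * (12 / (z\<^sup>2 - 6 * z + 12))"
  using rho_denominator[of z] by (simp add: \<rho>_def field_simps)

text \<open>\<open>\<rho>\<close> is the (2,2) Pade approximant of \<open>exp\<close>. The cubic error term below comes from the agreement
  of both functions with \<open>1 + b + b\<^sup>2 / 2\<close>.\<close>

lemma exp_minus_rho:
  assumes a: "\<bar>a\<bar> \<le> R" and b: "\<bar>b\<bar> \<le> R"
  shows "\<bar>exp a - \<rho> b\<bar> \<le> exp R * \<bar>a - b\<bar> + (exp R + 2 + R) * \<bar>b\<bar> ^ 3"
proof -
  have 1: "\<bar>exp a - exp b\<bar> \<le> exp R * \<bar>a - b\<bar>"
    using field_differentiable_bound[of "{-R..R}" exp exp "exp R" a b] a b
    by (auto simp: abs_le_iff intro: DERIV_subset[OF DERIV_exp])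
  have 2: "\<bar>exp b - (1 + b + b\<^sup>2 / 2)\<bar> \<le> exp R * \<bar>b\<bar> ^ 3"
  proof -
    have "norm (exp b - (\<Sum>i\<le>2. exp 0 * (b - 0) ^ i / fact i))
        \<le> exp R * norm (b - 0) ^ Suc 2 / fact 2"
      using b by (intro field_Taylor[of "{-R..R}" 2 "\<lambda>_. exp"])
        (auto simp: abs_le_iff intro: DERIV_subset[OF DERIV_exp])
    then have "\<bar>exp b - (1 + b + b\<^sup>2 / 2)\<bar> \<le> exp R * \<bar>b\<bar> ^ 3 / 2"
      by (simp add: numeral_2_eq_2 numeral_3_eq_3)
    moreover have "exp R * \<bar>b\<bar> ^ 3 \<ge> 0" by simp
    ultimately show ?thesis by linarith
  qed
  have 3: "\<bar>(1 + b + b\<^sup>2 / 2) - \<rho> b\<bar> \<le> (2 + R) * \<bar>b\<bar> ^ 3"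
  proof -
    let ?D = "b\<^sup>2 - 6 * b + 12"
    have D: "?D \<ge> 3" by (rule rho_denominator)
    have "(1 + b + b\<^sup>2 / 2) - \<rho> b = ((1 + b + b\<^sup>2 / 2) * ?D - (b\<^sup>2 + 6 * b + 12)) / ?D"
      using D by (simp add: \<rho>_def diff_divide_eq_iff del: distrib_right_numeral)
    also have "(1 + b + b\<^sup>2 / 2) * ?D - (b\<^sup>2 + 6 * b + 12) = b ^ 3 * (b / 2 - 2)"
      by (simp add: power2_eq_square power3_eq_cube field_simps)
    also have "\<bar>b ^ 3 * (b / 2 - 2) / ?D\<bar> = \<bar>b\<bar> ^ 3 * (\<bar>b / 2 - 2\<bar> / ?D)"
      using D by (simp add: abs_mult power_abs)
    also have "\<dots> \<le> \<bar>b\<bar> ^ 3 * ((2 + R) / 1)"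
      using D b by (intro mult_left_mono frac_le) auto
    finally show ?thesis by (simp add: mult.commute)
  qed
  show ?thesis
    using 1 2 3 unfolding distrib_right by linarith
qed

section \<open>One step of the integrator\<close>

lemma weighted_rho_sum_ge:
  assumes "\<xi> \<in> prob_simplex"
  shows "(\<Sum>j\<in>UNIV. \<xi> $ j * \<rho> (z j)) \<ge> 1 / 14"
proof -
  have "(\<Sum>j\<in>UNIV. \<xi> $ j * (1 / 14)) \<le> (\<Sum>j\<in>UNIV. \<xi> $ j * \<rho> (z j))"
    using prob_simplexD(2)[OF assms] rho_ge by (intro sum_mono mult_left_mono) auto
  then show ?thesis
    using prob_simplexD(1)[OF assms] by (simp flip: sum_distrib_right sum_divide_distrib)
qed

lemma nri_stage_in_simplex:
  assumes "\<xi> \<in> prob_simplex"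
  shows "nri_stage f \<tau> \<xi> y \<in> prob_simplex"
proof -
  let ?D = "\<Sum>j\<in>UNIV. \<xi> $ j * \<rho> (\<tau> * replicator_F f j y)"
  have D: "?D \<ge> 1 / 14" by (rule weighted_rho_sum_ge[OF assms])
  then have "?D \<noteq> 0" "?D > 0" by linarith+
  then show ?thesis
    using prob_simplexD(2)[OF assms] rho_pos
    by (auto simp: prob_simplex_def nri_stage_def less_imp_le simp flip: sum_divide_distrib)
qed

lemma nri_step_in_simplex: "\<xi> \<in> prob_simplex \<Longrightarrow> nri_step f h \<xi> \<in> prob_simplex"
  unfolding nri_step_def by (intro nri_stage_in_simplex)

lemma nri_in_simplex: "\<xi> \<in> prob_simplex \<Longrightarrow> nri f h \<xi> n \<in> prob_simplex"
  by (induction n) (simp_all add: nri_step_in_simplex)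

text \<open>The exact flow multiplies the components by factors \<open>exp (a i)\<close> that need no normalization.
  Hence the normalizing sum of the integrator differs from \<open>1\<close> only by the weighted mean of
  the errors of its factors, and normalization at most doubles the error in the \<open>l\<^sub>1\<close> norm.\<close>

lemma nri_stage_error:
  fixes \<xi> y z :: "real^'n::finite"
  assumes \<xi>: "\<xi> \<in> prob_simplex" and z: "z \<in> prob_simplex"
    and za: "\<And>i. z $ i = \<xi> $ i * exp (a i)"
    and \<delta>: "\<And>i. \<bar>exp (a i) - \<rho> (\<tau> * replicator_F f i y)\<bar> \<le> \<delta>"
  shows "norm (z - nri_stage f \<tau> \<xi> y) \<le> 2 * \<delta>"
proof -
  define r where "r i = \<rho> (\<tau> * replicator_F f i y)" for i
  define D where "D = (\<Sum>j\<in>UNIV. \<xi> $ j * r j)"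
  let ?s = "nri_stage f \<tau> \<xi> y"
  have s: "?s \<in> prob_simplex" by (rule nri_stage_in_simplex[OF \<xi>])
  have "D \<ge> 1 / 14" unfolding D_def r_def by (rule weighted_rho_sum_ge[OF \<xi>])
  then have "D \<noteq> 0" by linarith
  then have sD: "?s $ i * D = \<xi> $ i * r i" for i
    by (simp add: nri_stage_def D_def r_def)
  have "D - 1 = (\<Sum>j\<in>UNIV. \<xi> $ j * (r j - exp (a j)))"
    using prob_simplexD(1)[OF z] by (simp add: D_def za right_diff_distrib sum_subtractf)
  also have "\<bar>\<dots>\<bar> \<le> (\<Sum>j\<in>UNIV. \<xi> $ j * \<delta>)"
    using \<delta> prob_simplexD(2)[OF \<xi>]
    by (intro order.trans[OF sum_abs] sum_mono)
      (auto simp: abs_mult r_def abs_minus_commute intro!: mult_left_mono)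
  finally have D1: "\<bar>D - 1\<bar> \<le> \<delta>"
    using prob_simplexD(1)[OF \<xi>] by (simp flip: sum_distrib_right)
  have "\<bar>(z - ?s) $ i\<bar> \<le> \<xi> $ i * \<delta> + ?s $ i * \<delta>" for i
  proof -
    have "(z - ?s) $ i = \<xi> $ i * (exp (a i) - r i) + ?s $ i * (D - 1)"
      using sD[of i] by (simp add: za algebra_simps)
    also have "\<bar>\<dots>\<bar> \<le> \<bar>\<xi> $ i * (exp (a i) - r i)\<bar> + \<bar>?s $ i * (D - 1)\<bar>"
      by (rule abs_triangle_ineq)
    also have "\<dots> \<le> \<xi> $ i * \<delta> + ?s $ i * \<delta>"
      using \<delta>[of i] D1 prob_simplexD(2)[OF \<xi>, of i] prob_simplexD(2)[OF s, of i]
      by (auto simp: abs_mult r_def intro!: add_mono mult_left_mono)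
    finally show ?thesis .
  qed
  then have "(\<Sum>i\<in>UNIV. \<bar>(z - ?s) $ i\<bar>) \<le> (\<Sum>i\<in>UNIV. \<xi> $ i * \<delta> + ?s $ i * \<delta>)"
    by (intro sum_mono)
  also have "\<dots> = 2 * \<delta>"
    using prob_simplexD(1)[OF \<xi>] prob_simplexD(1)[OF s]
    by (simp add: sum.distrib flip: sum_distrib_right)
  finally show ?thesis
    using norm_le_l1_cart[of "z - ?s"] by linarith
qed

section \<open>Local error\<close>

lemma Ck_curve_bounded:
  assumes "Ck_curve k {a..b} u"
  shows "\<exists>B\<ge>0. \<forall>t\<in>{a..b}. \<bar>u t\<bar> \<le> B"
proof -
  have "continuous_on {a..b} u"
    using assms by (induction k) (auto dest: Ck_curve_SucD simp del: Ck_curve.simps(2))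
  then have "bounded (u ` {a..b})"
    by (intro compact_imp_bounded compact_continuous_image) auto
  then show ?thesis
    by (metis bounded_iff image_eqI norm_ge_zero order.trans real_norm_def linear)
qed

lemma rectangle_rule_error:
  assumes u: "Ck_curve 1 {a..b} u"
    and A: "\<And>t. t \<in> {a..b} \<Longrightarrow> (A has_real_derivative u t) (at t within {a..b})"
  shows "\<exists>C\<ge>0. \<forall>s\<in>{a..b}. \<forall>t\<in>{a..b}. \<bar>A t - A s - (t - s) * u s\<bar> \<le> C * (t - s)\<^sup>2"
proof -
  obtain u' where u': "\<And>t. t \<in> {a..b} \<Longrightarrow> (u has_real_derivative u' t) (at t within {a..b})"
    and "Ck_curve 0 {a..b} u'"
    using u unfolding One_nat_def Ck_curve.simps(2) by blast
  from Ck_curve_bounded[OF this(2)] obtain C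
    where C: "C \<ge> 0" "\<And>t. t \<in> {a..b} \<Longrightarrow> \<bar>u' t\<bar> \<le> C" by auto
  have "\<bar>A t - A s - (t - s) * u s\<bar> \<le> C * (t - s)\<^sup>2" if "s \<in> {a..b}" "t \<in> {a..b}" for s t
  proof -
    have "norm ((!) [A, u, u'] 0 t - (\<Sum>i\<le>1. (!) [A, u, u'] i s * (t - s) ^ i / fact i))
        \<le> C * norm (t - s) ^ Suc 1 / fact 1"
      using A u' C that by (intro field_Taylor[of "{a..b}" 1]) (auto simp: le_Suc_eq)
    then show ?thesis by (simp add: algebra_simps power2_eq_square abs_mult_self_eq)
  qed
  then show ?thesis using C(1) by blast
qed

text \<open>Expanding at the midpoint, the quadratic terms for the two end points cancel.\<close>

lemma midpoint_rule_error:
  assumes u: "Ck_curve 2 {a..b} u"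
    and A: "\<And>t. t \<in> {a..b} \<Longrightarrow> (A has_real_derivative u t) (at t within {a..b})"
  shows "\<exists>C\<ge>0. \<forall>t h. a \<le> t \<longrightarrow> 0 \<le> h \<longrightarrow> t + h \<le> b \<longrightarrow>
    \<bar>A (t + h) - A t - h * u (t + h / 2)\<bar> \<le> C * h ^ 3"
proof -
  obtain u' u'' where u': "\<And>t. t \<in> {a..b} \<Longrightarrow> (u has_real_derivative u' t) (at t within {a..b})"
    and u'': "\<And>t. t \<in> {a..b} \<Longrightarrow> (u' has_real_derivative u'' t) (at t within {a..b})"
    and "Ck_curve 0 {a..b} u''"
    using u unfolding numeral_2_eq_2 Ck_curve.simps(2) by blast
  from Ck_curve_bounded[OF this(3)] obtain C
    where C: "C \<ge> 0" "\<And>t. t \<in> {a..b} \<Longrightarrow> \<bar>u'' t\<bar> \<le> C" by auto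
  have T: "\<bar>A t - (A s + u s * (t - s) + u' s * (t - s)\<^sup>2 / 2)\<bar> \<le> C * \<bar>t - s\<bar> ^ 3 / 2"
    if "s \<in> {a..b}" "t \<in> {a..b}" for s t
  proof -
    have "norm ((!) [A, u, u', u''] 0 t - (\<Sum>i\<le>2. (!) [A, u, u', u''] i s * (t - s) ^ i / fact i))
        \<le> C * norm (t - s) ^ Suc 2 / fact 2"
      using A u' u'' C that
      by (intro field_Taylor[of "{a..b}" 2]) (auto simp: le_Suc_eq numeral_2_eq_2)
    then show ?thesis by (simp add: numeral_2_eq_2 numeral_3_eq_3)
  qed
  have "\<bar>A (t + h) - A t - h * u (t + h / 2)\<bar> \<le> C * h ^ 3" if "a \<le> t" "0 \<le> h" "t + h \<le> b" for t h
  proof -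
    let ?m = "t + h / 2" and ?q = "u' (t + h / 2) * (h / 2)\<^sup>2 / 2" and ?e = "C * (h / 2) ^ 3 / 2"
    have m: "?m \<in> {a..b}" "t + h \<in> {a..b}" "t \<in> {a..b}" using that by auto
    have d: "(t + h) - ?m = h / 2" "t - ?m = - (h / 2)" by simp_all
    have "\<bar>A (t + h) - (A ?m + u ?m * (h / 2) + ?q)\<bar> \<le> ?e"
      using T[OF m(1,2)] that(2) unfolding d by simp
    moreover have "\<bar>A t - (A ?m + u ?m * - (h / 2) + ?q)\<bar> \<le> ?e"
      using T[OF m(1,3)] that(2) unfolding d by simp
    moreover have "A (t + h) - A t - h * u ?m
      = (A (t + h) - (A ?m + u ?m * (h / 2) + ?q)) - (A t - (A ?m + u ?m * - (h / 2) + ?q))"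
      by (simp add: algebra_simps)
    ultimately have "\<bar>A (t + h) - A t - h * u ?m\<bar> \<le> ?e + ?e" by linarith
    also have "\<dots> \<le> C * h ^ 3"
      using C(1) that(2) by (simp add: power_divide mult_left_mono)
    finally show ?thesis .
  qed
  then show ?thesis using C(1) by blast
qed

lemma finite_uniform_constant:
  fixes P :: "'n::finite \<Rightarrow> real \<Rightarrow> bool"
  assumes "\<And>i. \<exists>C\<ge>0. P i C" "\<And>i C D. P i C \<Longrightarrow> C \<le> D \<Longrightarrow> P i D"
  shows "\<exists>C\<ge>0. \<forall>i. P i C"
proof -
  obtain C where C: "\<And>i. C i \<ge> 0" "\<And>i. P i (C i)"
    using assms(1) by metis
  have "P i (\<Sum>i\<in>UNIV. C i)" for i
    using C by (intro assms(2)[OF C(2)] member_le_sum) auto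
  then show ?thesis
    using C(1) by (intro exI[of _ "\<Sum>i\<in>UNIV. C i"]) (auto intro: sum_nonneg)
qed

text \<open>Along the solution \<open>x\<^sub>i (t + h) = x\<^sub>i (t) exp (\<integral> F\<^sub>i (x))\<close>. The half step replaces the integral
  over \<open>{t..t + h/2}\<close> by the rectangle rule, with error \<open>O(h\<^sup>2)\<close>. The full step uses the midpoint
  rule, with error \<open>O(h\<^sup>3)\<close>, and evaluates \<open>F\<^sub>i\<close> at the half step instead of \<open>x (t + h/2)\<close>, which
  costs a further \<open>h O(h\<^sup>2)\<close>. The replacement of \<open>exp\<close> by \<open>\<rho>\<close> adds \<open>O(h\<^sup>3)\<close>.\<close>

lemma nri_local_error:
  fixes x :: "real \<Rightarrow> real^'n::finite"
  assumes sol: "replicator_solution f T x" and inv: "\<And>t. t \<in> {0..T} \<Longrightarrow> x t \<in> prob_simplex"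
    and smooth: "\<And>i. Ck_curve 2 {0..T} (\<lambda>t. replicator_F f i (x t))"
    and K: "0 \<le> K" "\<And>i \<xi>. \<xi> \<in> prob_simplex \<Longrightarrow> \<bar>replicator_F f i \<xi>\<bar> \<le> K"
    and L: "0 \<le> L" "\<And>i \<xi> \<eta>. \<xi> \<in> prob_simplex \<Longrightarrow> \<eta> \<in> prob_simplex \<Longrightarrow>
      \<bar>replicator_F f i \<xi> - replicator_F f i \<eta>\<bar> \<le> L * norm (\<xi> - \<eta>)"
  shows "\<exists>C\<ge>0. \<forall>t h. 0 \<le> t \<longrightarrow> 0 \<le> h \<longrightarrow> t + h \<le> T \<longrightarrow>
    norm (x (t + h) - nri_step f h (x t)) \<le> C * h ^ 3"
proof -
  define F where "F i t = replicator_F f i (x t)" for i t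
  define A where "A i t = integral {0..t} (F i)" for i t
  have C2: "Ck_curve 2 {0..T} (F i)" for i
    using smooth[of i] by (simp add: F_def[abs_def] del: Ck_curve.simps)
  then have C1: "Ck_curve 1 {0..T} (F i)" for i
    using Ck_curve_SucD[of 1 _ "F i"] by (simp add: numeral_2_eq_2 del: Ck_curve.simps)
  then have C0: "continuous_on {0..T} (F i)" for i
    using Ck_curve_SucD[of 0 _ "F i"] by simp
  have dA: "(A i has_real_derivative F i t) (at t within {0..T})" if "t \<in> {0..T}" for i t
    unfolding A_def[abs_def] using C0 that by (rule integral_has_real_derivative)
  have flow: "x t $ i = x s $ i * exp (A i t - A i s)" if "s \<in> {0..T}" "t \<in> {0..T}" for i s t
  proof (rule linear_ode_solution[OF _ _ dA that])
    fix s assume "s \<in> {0..T}"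
    then show "((\<lambda>s. x s $ i) has_real_derivative x s $ i * F i s) (at s within {0..T})"
      using sol by (simp add: replicator_solution_def F_def replicator_F_def)
  qed simp
  have A_le: "\<bar>A i t - A i s\<bar> \<le> K * \<bar>t - s\<bar>" if "s \<in> {0..T}" "t \<in> {0..T}" for i s t
  proof -
    have "norm (F i r) \<le> K" if "r \<in> {0..T}" for r
      using K(2) inv that by (simp add: F_def)
    then show ?thesis
      using field_differentiable_bound[OF _ dA, where B = K and x = t and y = s] that by simp
  qed

  have "\<exists>C\<ge>0. \<forall>i. \<forall>s\<in>{0..T}. \<forall>t\<in>{0..T}. \<bar>A i t - A i s - (t - s) * F i s\<bar> \<le> C * (t - s)\<^sup>2"
  proof (rule finite_uniform_constant)
    fix i C D assume "C \<le> (D::real)" and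
      "\<forall>s\<in>{0..T}. \<forall>t\<in>{0..T}. \<bar>A i t - A i s - (t - s) * F i s\<bar> \<le> C * (t - s)\<^sup>2"
    then show "\<forall>s\<in>{0..T}. \<forall>t\<in>{0..T}. \<bar>A i t - A i s - (t - s) * F i s\<bar> \<le> D * (t - s)\<^sup>2"
      by (blast intro: order.trans mult_right_mono zero_le_power2)
  qed (rule rectangle_rule_error[OF C1 dA])
  then obtain R1 where R1: "R1 \<ge> 0" "\<And>i s t. s \<in> {0..T} \<Longrightarrow> t \<in> {0..T} \<Longrightarrow>
      \<bar>A i t - A i s - (t - s) * F i s\<bar> \<le> R1 * (t - s)\<^sup>2"
    by blast

  have "\<exists>C\<ge>0. \<forall>i. \<forall>t h. 0 \<le> t \<longrightarrow> 0 \<le> h \<longrightarrow> t + h \<le> T \<longrightarrow>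
      \<bar>A i (t + h) - A i t - h * F i (t + h / 2)\<bar> \<le> C * h ^ 3"
  proof (rule finite_uniform_constant)
    fix i C D assume "C \<le> (D::real)" and "\<forall>t h. 0 \<le> t \<longrightarrow> 0 \<le> h \<longrightarrow> t + h \<le> T \<longrightarrow>
      \<bar>A i (t + h) - A i t - h * F i (t + h / 2)\<bar> \<le> C * h ^ 3"
    then show "\<forall>t h. 0 \<le> t \<longrightarrow> 0 \<le> h \<longrightarrow> t + h \<le> T \<longrightarrow>
      \<bar>A i (t + h) - A i t - h * F i (t + h / 2)\<bar> \<le> D * h ^ 3"
      by (blast intro: order.trans mult_right_mono zero_le_power)
  qed (rule midpoint_rule_error[OF C2 dA])
  then obtain R2 where R2: "R2 \<ge> 0" "\<And>i t h. 0 \<le> t \<Longrightarrow> 0 \<le> h \<Longrightarrow> t + h \<le> T \<Longrightarrow>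
      \<bar>A i (t + h) - A i t - h * F i (t + h / 2)\<bar> \<le> R2 * h ^ 3"
    by blast

  define E where "E = exp (K * T)"
  define P where "P = (E + 2 + K * T) * K ^ 3"
  define D1 where "D1 = E * R1 + P * T"
  define D2 where "D2 = E * (R2 + L * (2 * D1)) + P"
  (* shared by both stages: exp against \<rho> once the exponents are known to be close *)
  have factor: "\<bar>exp (A i (t + k) - A i t) - \<rho> (k * q)\<bar> \<le> E * \<epsilon> + P * k ^ 3"
    if "0 \<le> t" "0 \<le> k" "t + k \<le> T" "\<bar>q\<bar> \<le> K" "\<bar>A i (t + k) - A i t - k * q\<bar> \<le> \<epsilon>"
    for i t k q \<epsilon>
  proof -
    have kT: "K * k \<le> K * T" using that K(1) by (intro mult_left_mono) auto
    have "\<bar>A i (t + k) - A i t\<bar> \<le> K * k"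
      using A_le[of t "t + k" i] that by simp
    then have a: "\<bar>A i (t + k) - A i t\<bar> \<le> K * T" using kT by linarith
    have kq: "\<bar>k * q\<bar> \<le> K * k"
      using that(2,4) by (simp add: abs_mult mult.commute[of K] mult_left_mono)
    then have b: "\<bar>k * q\<bar> \<le> K * T" using kT by linarith
    have KT: "0 \<le> K * T" using K(1) that by simp
    have "\<bar>exp (A i (t + k) - A i t) - \<rho> (k * q)\<bar>
        \<le> E * \<bar>A i (t + k) - A i t - k * q\<bar> + (E + 2 + K * T) * \<bar>k * q\<bar> ^ 3"
      unfolding E_def using a b by (rule exp_minus_rho)
    also have "\<dots> \<le> E * \<epsilon> + (E + 2 + K * T) * (K * k) ^ 3"
      using that(5) KT kq by (intro add_mono mult_left_mono power_mono) (auto simp: E_def)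
    finally show ?thesis
      by (simp add: P_def power_mult_distrib mult.assoc)
  qed

  have "norm (x (t + h) - nri_step f h (x t)) \<le> (2 * D2) * h ^ 3"
    if t: "0 \<le> t" and h: "0 \<le> h" and th: "t + h \<le> T" for t h
  proof -
    define y where "y = nri_stage f (h / 2) (x t) (x t)"
    have in0: "t \<in> {0..T}" "t + h / 2 \<in> {0..T}" "t + h \<in> {0..T}"
      using that by auto
    have xt: "x t \<in> prob_simplex" using inv in0 by blast
    have y: "y \<in> prob_simplex" unfolding y_def by (rule nri_stage_in_simplex[OF xt])
    have KT: "0 \<le> K * T" and P: "P \<ge> 0" and E: "E \<ge> 0"
      using K(1) that by (auto simp: P_def E_def add_nonneg_nonneg)
    have "norm (x (t + h / 2) - y) \<le> 2 * (D1 * h\<^sup>2)"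
      unfolding y_def
    proof (rule nri_stage_error[OF xt inv[OF in0(2)] flow[OF in0(1,2)]])
      fix i
      have "\<bar>A i (t + h / 2) - A i t - h / 2 * F i t\<bar> \<le> R1 * (h / 2)\<^sup>2"
        using R1(2)[OF in0(1,2), of i] by simp
      also have "\<dots> \<le> R1 * h\<^sup>2"
        using R1(1) h by (intro mult_left_mono power_mono) auto
      finally have "\<bar>exp (A i (t + h / 2) - A i t) - \<rho> (h / 2 * F i t)\<bar>
          \<le> E * (R1 * h\<^sup>2) + P * (h / 2) ^ 3"
        using that K(2)[OF xt] by (intro factor) (auto simp: F_def)
      also have "P * (h / 2) ^ 3 \<le> P * (T * h\<^sup>2)"
      proof (rule mult_left_mono[OF _ P])
        have "(h / 2) ^ 3 \<le> h ^ 3" using h by (intro power_mono) auto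
        also have "\<dots> = h * h\<^sup>2" by (simp add: power3_eq_cube power2_eq_square)
        also have "\<dots> \<le> T * h\<^sup>2" using that by (intro mult_right_mono) auto
        finally show "(h / 2) ^ 3 \<le> T * h\<^sup>2" .
      qed
      finally show "\<bar>exp (A i (t + h / 2) - A i t) - \<rho> (h / 2 * replicator_F f i (x t))\<bar> \<le> D1 * h\<^sup>2"
        by (simp add: D1_def F_def algebra_simps)
    qed
    then have half: "L * norm (x (t + h / 2) - y) \<le> L * (2 * D1) * h\<^sup>2"
      using L(1) mult_left_mono[of _ _ L] by (fastforce simp: mult.assoc)
    have "norm (x (t + h) - nri_stage f h (x t) y) \<le> 2 * (D2 * h ^ 3)"
    proof (rule nri_stage_error[OF xt inv[OF in0(3)] flow[OF in0(1,3)]])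
      fix i
      have "A i (t + h) - A i t - h * replicator_F f i y = (A i (t + h) - A i t - h * F i (t + h / 2))
          + h * (replicator_F f i (x (t + h / 2)) - replicator_F f i y)"
        by (simp add: F_def algebra_simps)
      also have "\<bar>\<dots>\<bar> \<le> R2 * h ^ 3 + h * (L * norm (x (t + h / 2) - y))"
        using R2(2)[OF that] L(2)[OF inv[OF in0(2)] y] h
        by (intro order.trans[OF abs_triangle_ineq] add_mono) (auto simp: abs_mult mult_left_mono)
      also have "\<dots> \<le> R2 * h ^ 3 + h * (L * (2 * D1) * h\<^sup>2)"
        using half h by (intro add_left_mono mult_left_mono) auto
      also have "\<dots> = (R2 + L * (2 * D1)) * h ^ 3"
        by (simp add: algebra_simps power2_eq_square power3_eq_cube)
      finally have "\<bar>exp (A i (t + h) - A i t) - \<rho> (h * replicator_F f i y)\<bar>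
          \<le> E * ((R2 + L * (2 * D1)) * h ^ 3) + P * h ^ 3"
        using that K(2)[OF y] by (intro factor)
      then show "\<bar>exp (A i (t + h) - A i t) - \<rho> (h * replicator_F f i y)\<bar> \<le> D2 * h ^ 3"
        by (simp add: D2_def algebra_simps)
    qed
    then show ?thesis
      by (simp add: nri_step_def y_def)
  qed
  moreover have "2 * D2 \<ge> 0" if "0 \<le> T"
    using that K(1) L(1) R1(1) R2(1) by (auto simp: D2_def D1_def P_def E_def)
  ultimately show ?thesis
    by (cases "0 \<le> T") (blast, auto intro: exI[of _ 0])
qed

section \<open>Stability\<close>

text \<open>The Lipschitz constants below must not depend on the step size; \<open>p\<close> is the parameter in which
  the bounds are uniform. Boundedness is included because products need it.\<close>

definition bdd_Lipschitz :: "'p set \<Rightarrow> 'a::metric_space set \<Rightarrow> ('p \<Rightarrow> 'a \<Rightarrow> real) \<Rightarrow> bool" where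
  "bdd_Lipschitz P S u \<longleftrightarrow>
     (\<exists>B\<ge>0. \<forall>p\<in>P. \<forall>x\<in>S. \<bar>u p x\<bar> \<le> B \<and> (\<forall>y\<in>S. \<bar>u p x - u p y\<bar> \<le> B * dist x y))"

lemma bdd_LipschitzI:
  assumes "0 \<le> B" "\<And>p x. p \<in> P \<Longrightarrow> x \<in> S \<Longrightarrow> \<bar>u p x\<bar> \<le> B"
    "\<And>p x y. p \<in> P \<Longrightarrow> x \<in> S \<Longrightarrow> y \<in> S \<Longrightarrow> \<bar>u p x - u p y\<bar> \<le> B * dist x y"
  shows "bdd_Lipschitz P S u"
  using assms unfolding bdd_Lipschitz_def by blast

lemma bdd_Lipschitz_param:
  assumes "\<And>p. p \<in> P \<Longrightarrow> \<bar>c p\<bar> \<le> B"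
  shows "bdd_Lipschitz P S (\<lambda>p _. c p)"
  using assms by (intro bdd_LipschitzI[of "\<bar>B\<bar>"]) (auto intro: order.trans[OF _ abs_ge_self])

lemma bdd_Lipschitz_const: "bdd_Lipschitz P S (\<lambda>_ _. c)"
  by (rule bdd_Lipschitz_param[OF order.refl])

lemma bdd_Lipschitz_add:
  assumes "bdd_Lipschitz P S u" "bdd_Lipschitz P S v"
  shows "bdd_Lipschitz P S (\<lambda>p x. u p x + v p x)"
proof -
  obtain B where B: "0 \<le> B" "\<And>p x. p \<in> P \<Longrightarrow> x \<in> S \<Longrightarrow> \<bar>u p x\<bar> \<le> B"
    "\<And>p x y. p \<in> P \<Longrightarrow> x \<in> S \<Longrightarrow> y \<in> S \<Longrightarrow> \<bar>u p x - u p y\<bar> \<le> B * dist x y"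
    using assms(1) unfolding bdd_Lipschitz_def by blast
  obtain C where C: "0 \<le> C" "\<And>p x. p \<in> P \<Longrightarrow> x \<in> S \<Longrightarrow> \<bar>v p x\<bar> \<le> C"
    "\<And>p x y. p \<in> P \<Longrightarrow> x \<in> S \<Longrightarrow> y \<in> S \<Longrightarrow> \<bar>v p x - v p y\<bar> \<le> C * dist x y"
    using assms(2) unfolding bdd_Lipschitz_def by blast
  show ?thesis
  proof (rule bdd_LipschitzI)
    fix p x y assume "p \<in> P" "x \<in> S" "y \<in> S"
    from B(3)[OF this] C(3)[OF this]
    show "\<bar>u p x + v p x - (u p y + v p y)\<bar> \<le> (B + C) * dist x y"
      unfolding distrib_right by linarith
  next
    fix p x assume "p \<in> P" "x \<in> S"
    from B(2)[OF this] C(2)[OF this] show "\<bar>u p x + v p x\<bar> \<le> B + C" by linarith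
  qed (use B(1) C(1) in simp)
qed

lemma bdd_Lipschitz_mult:
  assumes "bdd_Lipschitz P S u" "bdd_Lipschitz P S v"
  shows "bdd_Lipschitz P S (\<lambda>p x. u p x * v p x)"
proof -
  obtain B where B: "0 \<le> B" "\<And>p x. p \<in> P \<Longrightarrow> x \<in> S \<Longrightarrow> \<bar>u p x\<bar> \<le> B"
    "\<And>p x y. p \<in> P \<Longrightarrow> x \<in> S \<Longrightarrow> y \<in> S \<Longrightarrow> \<bar>u p x - u p y\<bar> \<le> B * dist x y"
    using assms(1) unfolding bdd_Lipschitz_def by blast
  obtain C where C: "0 \<le> C" "\<And>p x. p \<in> P \<Longrightarrow> x \<in> S \<Longrightarrow> \<bar>v p x\<bar> \<le> C"
    "\<And>p x y. p \<in> P \<Longrightarrow> x \<in> S \<Longrightarrow> y \<in> S \<Longrightarrow> \<bar>v p x - v p y\<bar> \<le> C * dist x y"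
    using assms(2) unfolding bdd_Lipschitz_def by blast
  show ?thesis
  proof (rule bdd_LipschitzI)
    fix p x y assume *: "p \<in> P" "x \<in> S" "y \<in> S"
    have "u p x * v p x - u p y * v p y = u p x * (v p x - v p y) + (u p x - u p y) * v p y"
      by (simp add: algebra_simps)
    also have "\<bar>\<dots>\<bar> \<le> B * (C * dist x y) + (B * dist x y) * C"
      using B(2)[OF *(1,2)] B(3)[OF *] C(2)[OF *(1,3)] C(3)[OF *] B(1) C(1)
      by (intro order.trans[OF abs_triangle_ineq] add_mono) (auto simp: abs_mult intro!: mult_mono)
    finally show "\<bar>u p x * v p x - u p y * v p y\<bar> \<le> (2 * (B * C)) * dist x y"
      by (simp add: algebra_simps)
  next
    fix p x assume "p \<in> P" "x \<in> S"
    then have "\<bar>u p x * v p x\<bar> \<le> B * C"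
      unfolding abs_mult using B C by (intro mult_mono) auto
    moreover have "0 \<le> B * C" using B(1) C(1) by simp
    ultimately show "\<bar>u p x * v p x\<bar> \<le> 2 * (B * C)" by linarith
  qed (use B(1) C(1) in simp)
qed

lemma bdd_Lipschitz_diff:
  assumes "bdd_Lipschitz P S u" "bdd_Lipschitz P S v"
  shows "bdd_Lipschitz P S (\<lambda>p x. u p x - v p x)"
  using bdd_Lipschitz_add[OF assms(1) bdd_Lipschitz_mult[OF bdd_Lipschitz_const[of P S "-1"] assms(2)]]
  by simp

lemma bdd_Lipschitz_sum:
  "finite I \<Longrightarrow> (\<And>i. i \<in> I \<Longrightarrow> bdd_Lipschitz P S (u i)) \<Longrightarrow>
    bdd_Lipschitz P S (\<lambda>p x. \<Sum>i\<in>I. u i p x)"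
  by (induction rule: finite_induct) (simp_all add: bdd_Lipschitz_add bdd_Lipschitz_const)

lemma bdd_Lipschitz_divide:
  assumes "bdd_Lipschitz P S u" "bdd_Lipschitz P S v"
    and c: "0 < c" "\<And>p x. p \<in> P \<Longrightarrow> x \<in> S \<Longrightarrow> c \<le> v p x"
  shows "bdd_Lipschitz P S (\<lambda>p x. u p x / v p x)"
proof -
  obtain C where C: "0 \<le> C" "\<And>p x. p \<in> P \<Longrightarrow> x \<in> S \<Longrightarrow> \<bar>v p x\<bar> \<le> C"
    "\<And>p x y. p \<in> P \<Longrightarrow> x \<in> S \<Longrightarrow> y \<in> S \<Longrightarrow> \<bar>v p x - v p y\<bar> \<le> C * dist x y"
    using assms(2) unfolding bdd_Lipschitz_def by blast
  have "bdd_Lipschitz P S (\<lambda>p x. 1 / v p x)"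
  proof (rule bdd_LipschitzI)
    fix p x y assume *: "p \<in> P" "x \<in> S" "y \<in> S"
    have pos: "c \<le> v p x" "c \<le> v p y" using c(2) * by auto
    then have "\<bar>1 / v p x - 1 / v p y\<bar> = \<bar>v p x - v p y\<bar> / (v p x * v p y)"
      using c(1) by (simp add: diff_divide_eq_iff divide_diff_eq_iff abs_mult abs_minus_commute)
    also have "\<dots> \<le> (C * dist x y) / (c * c)"
      using C(3)[OF *] c(1) pos C(1) by (intro frac_le mult_mono) auto
    also have "\<dots> \<le> (C * dist x y) / (c * c) + dist x y / c"
      using c(1) by simp
    also have "\<dots> = (C / (c * c) + 1 / c) * dist x y"
      by (simp add: distrib_right)
    finally show "\<bar>1 / v p x - 1 / v p y\<bar> \<le> (C / (c * c) + 1 / c) * dist x y" .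
  next
    fix p x assume "p \<in> P" "x \<in> S"
    then have "c \<le> v p x" by (rule c(2))
    then have "\<bar>1 / v p x\<bar> \<le> 1 / c"
      using c(1) by (simp add: frac_le)
    moreover have "0 \<le> C / (c * c)" using C(1) c(1) by simp
    ultimately show "\<bar>1 / v p x\<bar> \<le> C / (c * c) + 1 / c" by linarith
  qed (use C(1) c(1) in simp)
  from bdd_Lipschitz_mult[OF assms(1) this] show ?thesis by simp
qed

lemma bdd_Lipschitz_coord:
  "bdd_Lipschitz P (prob_simplex :: (real^'n::finite) set) (\<lambda>_ \<xi>. \<xi> $ i)"
proof (rule bdd_LipschitzI[of 1])
  show "\<bar>\<xi> $ i\<bar> \<le> 1" if "\<xi> \<in> prob_simplex" for \<xi> :: "real^'n"
    using prob_simplexD(2,3)[OF that, of i] by simp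
  show "\<bar>\<xi> $ i - \<eta> $ i\<bar> \<le> 1 * dist \<xi> \<eta>" for \<xi> \<eta> :: "real^'n"
    using component_le_norm_cart[of "\<xi> - \<eta>" i] by (simp add: dist_norm)
qed simp

lemma bdd_Lipschitz_compose:
  fixes y :: "'p \<Rightarrow> 'a::metric_space \<Rightarrow> real^'n::finite"
  assumes "0 \<le> K" "\<And>\<xi>. \<xi> \<in> Q \<Longrightarrow> \<bar>G \<xi>\<bar> \<le> K"
    and "0 \<le> L" "\<And>\<xi> \<eta>. \<xi> \<in> Q \<Longrightarrow> \<eta> \<in> Q \<Longrightarrow> \<bar>G \<xi> - G \<eta>\<bar> \<le> L * norm (\<xi> - \<eta>)"
    and y: "\<And>i. bdd_Lipschitz P S (\<lambda>p x. y p x $ i)" "\<And>p x. p \<in> P \<Longrightarrow> x \<in> S \<Longrightarrow> y p x \<in> Q"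
  shows "bdd_Lipschitz P S (\<lambda>p x. G (y p x))"
proof -
  have "\<exists>B\<ge>0. \<forall>p\<in>P. \<forall>x\<in>S. \<forall>x'\<in>S. \<bar>y p x $ i - y p x' $ i\<bar> \<le> B * dist x x'" for i
    using y(1)[of i] unfolding bdd_Lipschitz_def by blast
  then obtain B where B0: "\<And>i. 0 \<le> B i" and B: "\<And>i p x x'. p \<in> P \<Longrightarrow> x \<in> S \<Longrightarrow> x' \<in> S \<Longrightarrow>
      \<bar>y p x $ i - y p x' $ i\<bar> \<le> B i * dist x x'"
    by metis
  show ?thesis
  proof (rule bdd_LipschitzI)
    fix p x x' assume *: "p \<in> P" "x \<in> S" "x' \<in> S"
    have "norm (y p x - y p x') \<le> (\<Sum>i\<in>UNIV. \<bar>y p x $ i - y p x' $ i\<bar>)"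
      using norm_le_l1_cart[of "y p x - y p x'"] by simp
    also have "\<dots> \<le> (\<Sum>i\<in>UNIV. B i) * dist x x'"
      unfolding sum_distrib_right by (intro sum_mono B *)
    finally have "L * norm (y p x - y p x') \<le> L * ((\<Sum>i\<in>UNIV. B i) * dist x x')"
      using assms(3) by (rule mult_left_mono)
    moreover have "\<bar>G (y p x) - G (y p x')\<bar> \<le> L * norm (y p x - y p x')"
      using y(2) * by (intro assms(4))
    moreover have "0 \<le> K * dist x x'" using assms(1) by simp
    ultimately show "\<bar>G (y p x) - G (y p x')\<bar> \<le> (L * (\<Sum>i\<in>UNIV. B i) + K) * dist x x'"
      unfolding distrib_right mult.assoc by linarith
  next
    have LB: "0 \<le> L * (\<Sum>i\<in>UNIV. B i)"
      using assms(3) B0 by (simp add: sum_nonneg)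
    then show "0 \<le> L * (\<Sum>i\<in>UNIV. B i) + K" using assms(1) by linarith
    fix p x assume "p \<in> P" "x \<in> S"
    then have "\<bar>G (y p x)\<bar> \<le> K" by (intro assms(2) y(2))
    then show "\<bar>G (y p x)\<bar> \<le> L * (\<Sum>i\<in>UNIV. B i) + K" using LB by linarith
  qed
qed

text \<open>Since \<open>\<rho> z = 1 + z \<sigma> (z)\<close> with \<open>\<sigma> (z) = 12 / (z\<^sup>2 - 6 z + 12)\<close> and the \<open>\<xi>\<^sub>j\<close> sum to \<open>1\<close>, the
  stage is a perturbation of the identity of size \<open>\<tau>\<close>: with \<open>q\<^sub>j = F\<^sub>j (y) \<sigma> (\<tau> F\<^sub>j (y))\<close> it is
  \<open>\<xi>\<^sub>i + \<tau> \<xi>\<^sub>i (q\<^sub>i - \<Sigma>\<^sub>j \<xi>\<^sub>j q\<^sub>j) / (1 + \<tau> \<Sigma>\<^sub>j \<xi>\<^sub>j q\<^sub>j)\<close>. The factor \<open>\<tau>\<close> is what turns Lipschitz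
  continuity of the increment into stability over many steps.\<close>

lemma nri_stage_increment:
  fixes y :: "'p \<Rightarrow> real^'n::finite \<Rightarrow> real^'n"
  assumes K: "0 \<le> K" "\<And>i \<xi>. \<xi> \<in> prob_simplex \<Longrightarrow> \<bar>replicator_F f i \<xi>\<bar> \<le> K"
    and L: "0 \<le> L" "\<And>i \<xi> \<eta>. \<xi> \<in> prob_simplex \<Longrightarrow> \<eta> \<in> prob_simplex \<Longrightarrow>
      \<bar>replicator_F f i \<xi> - replicator_F f i \<eta>\<bar> \<le> L * norm (\<xi> - \<eta>)"
    and \<tau>: "\<And>p. p \<in> P \<Longrightarrow> \<bar>\<tau> p\<bar> \<le> T"
    and y: "\<And>i. bdd_Lipschitz P prob_simplex (\<lambda>p \<xi>. y p \<xi> $ i)"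
      "\<And>p \<xi>. p \<in> P \<Longrightarrow> \<xi> \<in> prob_simplex \<Longrightarrow> y p \<xi> \<in> prob_simplex"
  obtains \<Psi> where "\<And>i. bdd_Lipschitz P prob_simplex (\<Psi> i)"
    and "\<And>p \<xi> i. p \<in> P \<Longrightarrow> \<xi> \<in> prob_simplex \<Longrightarrow>
      nri_stage f (\<tau> p) \<xi> (y p \<xi>) $ i = \<xi> $ i + \<tau> p * \<Psi> i p \<xi>"
proof -
  define F where "F j p \<xi> = replicator_F f j (y p \<xi>)" for j p \<xi>
  define q where "q j p \<xi> = F j p \<xi> * (12 / ((\<tau> p * F j p \<xi>)\<^sup>2 - 6 * (\<tau> p * F j p \<xi>) + 12))" for j p \<xi>
  define D where "D p \<xi> = 1 + \<tau> p * (\<Sum>j\<in>UNIV. \<xi> $ j * q j p \<xi>)" for p \<xi>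
  define \<Psi> where "\<Psi> i p \<xi> = \<xi> $ i * (q i p \<xi> - (\<Sum>j\<in>UNIV. \<xi> $ j * q j p \<xi>)) / D p \<xi>" for i p \<xi>
  have \<rho>q: "\<rho> (\<tau> p * F j p \<xi>) = 1 + \<tau> p * q j p \<xi>" for j p \<xi>
    by (simp add: rho_eq q_def)
  have D: "(\<Sum>j\<in>UNIV. \<xi> $ j * \<rho> (\<tau> p * F j p \<xi>)) = D p \<xi>" if "\<xi> \<in> prob_simplex" for p \<xi>
    using prob_simplexD(1)[OF that]
    by (simp add: \<rho>q D_def distrib_left sum.distrib sum_distrib_left mult.left_commute)
  have D_ge: "1 / 14 \<le> D p \<xi>" if "\<xi> \<in> prob_simplex" for p \<xi>
    using weighted_rho_sum_ge[OF that] D[OF that] by metis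
  have F: "bdd_Lipschitz P prob_simplex (F j)" for j
    unfolding F_def[abs_def] using K L y by (rule bdd_Lipschitz_compose)
  have \<tau>_bl: "bdd_Lipschitz P prob_simplex (\<lambda>p _. \<tau> p)"
    using \<tau> by (rule bdd_Lipschitz_param)
  have q: "bdd_Lipschitz P prob_simplex (q j)" for j
    unfolding q_def[abs_def] power2_eq_square
  proof (intro bdd_Lipschitz_mult bdd_Lipschitz_divide bdd_Lipschitz_add bdd_Lipschitz_diff
      bdd_Lipschitz_const F \<tau>_bl)
    show "3 \<le> \<tau> p * F j p \<xi> * (\<tau> p * F j p \<xi>) - 6 * (\<tau> p * F j p \<xi>) + 12" for p \<xi>
      using rho_denominator[of "\<tau> p * F j p \<xi>"] by (simp add: power2_eq_square)
  qed simp
  have s: "bdd_Lipschitz P prob_simplex (\<lambda>p \<xi>. \<Sum>j\<in>UNIV. \<xi> $ j * q j p \<xi>)"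
    by (intro bdd_Lipschitz_sum bdd_Lipschitz_mult bdd_Lipschitz_coord q) simp
  have D_bl: "bdd_Lipschitz P prob_simplex D"
    unfolding D_def[abs_def] by (intro bdd_Lipschitz_add bdd_Lipschitz_mult bdd_Lipschitz_const \<tau>_bl s)
  have "bdd_Lipschitz P prob_simplex (\<Psi> i)" for i
    unfolding \<Psi>_def[abs_def]
    by (rule bdd_Lipschitz_divide[where c = "1 / 14"])
      (intro bdd_Lipschitz_mult bdd_Lipschitz_diff bdd_Lipschitz_coord q s D_bl, rule D_bl, simp,
        rule D_ge)
  moreover have "nri_stage f (\<tau> p) \<xi> (y p \<xi>) $ i = \<xi> $ i + \<tau> p * \<Psi> i p \<xi>"
    if "\<xi> \<in> prob_simplex" for p \<xi> i
  proof -
    have "D p \<xi> \<noteq> 0" using D_ge[OF that, of p] by linarith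
    moreover have "nri_stage f (\<tau> p) \<xi> (y p \<xi>) $ i = \<xi> $ i * (1 + \<tau> p * q i p \<xi>) / D p \<xi>"
      using D[OF that, of p] \<rho>q by (simp add: nri_stage_def F_def)
    ultimately show ?thesis
      by (simp add: \<Psi>_def field_simps) (simp add: D_def algebra_simps)
  qed
  ultimately show thesis by (rule that)
qed

text \<open>The increment of the half step shows that the half step is bounded and Lipschitz in \<open>\<xi>\<close>
  uniformly in \<open>h\<close>, so that it may serve as the point \<open>y\<close> of the full step.\<close>

lemma nri_step_stable:
  fixes f :: "'n::finite \<Rightarrow> real^'n \<Rightarrow> real"
  assumes K: "0 \<le> K" "\<And>i \<xi>. \<xi> \<in> prob_simplex \<Longrightarrow> \<bar>replicator_F f i \<xi>\<bar> \<le> K"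
    and L: "0 \<le> L" "\<And>i \<xi> \<eta>. \<xi> \<in> prob_simplex \<Longrightarrow> \<eta> \<in> prob_simplex \<Longrightarrow>
      \<bar>replicator_F f i \<xi> - replicator_F f i \<eta>\<bar> \<le> L * norm (\<xi> - \<eta>)"
  shows "\<exists>C\<ge>0. \<forall>h\<in>{0..T}. \<forall>\<xi>\<in>prob_simplex. \<forall>\<eta>\<in>prob_simplex.
    norm (nri_step f h \<xi> - nri_step f h \<eta>) \<le> (1 + C * h) * norm (\<xi> - \<eta>)"
proof -
  define y where "y h \<xi> = nri_stage f (h / 2) \<xi> \<xi>" for h \<xi>
  obtain \<Psi> where \<Psi>: "\<And>i. bdd_Lipschitz {0..T} prob_simplex (\<Psi> i)"
    "\<And>h \<xi> i. h \<in> {0..T} \<Longrightarrow> \<xi> \<in> prob_simplex \<Longrightarrow> y h \<xi> $ i = \<xi> $ i + h / 2 * \<Psi> i h \<xi>"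
    using nri_stage_increment[OF K L, where P = "{0..T}" and \<tau> = "\<lambda>h. h / 2" and T = T
        and y = "\<lambda>_ \<xi>. \<xi>"]
    by (auto simp: bdd_Lipschitz_coord y_def)
  have h: "bdd_Lipschitz {0..T} S (\<lambda>h _. h / 2)" for S
    by (rule bdd_Lipschitz_param[where B = T]) auto
  have y: "bdd_Lipschitz {0..T} prob_simplex (\<lambda>h \<xi>. y h \<xi> $ i)" for i
  proof -
    have "bdd_Lipschitz {0..T} prob_simplex (\<lambda>h \<xi>. \<xi> $ i + h / 2 * \<Psi> i h \<xi>)"
      by (intro bdd_Lipschitz_add bdd_Lipschitz_mult bdd_Lipschitz_coord h \<Psi>(1))
    then show ?thesis using \<Psi>(2) by (simp add: bdd_Lipschitz_def)
  qed
  obtain \<Phi> where \<Phi>: "\<And>i. bdd_Lipschitz {0..T} prob_simplex (\<Phi> i)"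
    "\<And>h \<xi> i. h \<in> {0..T} \<Longrightarrow> \<xi> \<in> prob_simplex \<Longrightarrow> nri_step f h \<xi> $ i = \<xi> $ i + h * \<Phi> i h \<xi>"
    using nri_stage_increment[OF K L, where P = "{0..T}" and \<tau> = "\<lambda>h. h" and T = T and y = y] y
    by (auto simp: nri_step_def y_def nri_stage_in_simplex)
  have "\<exists>B\<ge>0. \<forall>h\<in>{0..T}. \<forall>\<xi>\<in>prob_simplex. \<forall>\<eta>\<in>prob_simplex.
      \<bar>\<Phi> i h \<xi> - \<Phi> i h \<eta>\<bar> \<le> B * norm (\<xi> - \<eta>)" for i
    using \<Phi>(1)[of i] unfolding bdd_Lipschitz_def dist_norm by blast
  then obtain B where B0: "\<And>i. 0 \<le> B i"
    and B: "\<And>i h \<xi> \<eta>. h \<in> {0..T} \<Longrightarrow> \<xi> \<in> prob_simplex \<Longrightarrow> \<eta> \<in> prob_simplex \<Longrightarrow>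
      \<bar>\<Phi> i h \<xi> - \<Phi> i h \<eta>\<bar> \<le> B i * norm (\<xi> - \<eta>)"
    by metis
  have "norm (nri_step f h \<xi> - nri_step f h \<eta>) \<le> (1 + (\<Sum>i\<in>UNIV. B i) * h) * norm (\<xi> - \<eta>)"
    if *: "h \<in> {0..T}" "\<xi> \<in> prob_simplex" "\<eta> \<in> prob_simplex" for h \<xi> \<eta>
  proof -
    let ?v = "\<chi> i. \<Phi> i h \<xi> - \<Phi> i h \<eta>"
    have "norm ?v \<le> (\<Sum>i\<in>UNIV. \<bar>\<Phi> i h \<xi> - \<Phi> i h \<eta>\<bar>)"
      using norm_le_l1_cart[of ?v] by simp
    also have "\<dots> \<le> (\<Sum>i\<in>UNIV. B i) * norm (\<xi> - \<eta>)"
      unfolding sum_distrib_right by (intro sum_mono B *)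
    finally have "h * norm ?v \<le> h * ((\<Sum>i\<in>UNIV. B i) * norm (\<xi> - \<eta>))"
      using *(1) by (intro mult_left_mono) auto
    moreover have "nri_step f h \<xi> - nri_step f h \<eta> = (\<xi> - \<eta>) + h *\<^sub>R ?v"
      using \<Phi>(2) * by (simp add: vec_eq_iff algebra_simps)
    then have "norm (nri_step f h \<xi> - nri_step f h \<eta>) \<le> norm (\<xi> - \<eta>) + h * norm ?v"
      using *(1) norm_triangle_ineq[of "\<xi> - \<eta>" "h *\<^sub>R ?v"] by simp
    ultimately show ?thesis
      by (simp add: algebra_simps)
  qed
  then show ?thesis
    using B0 by (intro exI[of _ "\<Sum>i\<in>UNIV. B i"]) (auto intro: sum_nonneg)
qed

lemma replicator_F_bounded_Lipschitz:
  fixes g :: "'n::finite \<Rightarrow> real^'n \<Rightarrow> real"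
  assumes g: "\<And>i. Ck_on 1 (g i) U" and U: "prob_simplex \<subseteq> U"
  obtains K where "0 \<le> K" "\<And>i \<xi>. \<xi> \<in> prob_simplex \<Longrightarrow> \<bar>replicator_F g i \<xi>\<bar> \<le> K"
    "\<And>i \<xi> \<eta>. \<xi> \<in> prob_simplex \<Longrightarrow> \<eta> \<in> prob_simplex \<Longrightarrow>
      \<bar>replicator_F g i \<xi> - replicator_F g i \<eta>\<bar> \<le> K * norm (\<xi> - \<eta>)"
proof -
  have bl: "bdd_Lipschitz {()} prob_simplex (\<lambda>_. g i)" for i
  proof -
    obtain L where L: "0 \<le> L"
      "\<And>\<xi> \<eta>. \<xi> \<in> prob_simplex \<Longrightarrow> \<eta> \<in> prob_simplex \<Longrightarrow> \<bar>g i \<xi> - g i \<eta>\<bar> \<le> L * norm (\<xi> - \<eta>)"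
      using Ck_on_imp_Lipschitz[OF g U compact_prob_simplex convex_prob_simplex, of i] by blast
    have "continuous_on prob_simplex (g i)"
      using Ck_on_subset[OF Ck_on_SucD[of 0 "g i" U] U] g[of i] by simp
    then have "bounded (g i ` prob_simplex)"
      by (intro compact_imp_bounded compact_continuous_image compact_prob_simplex)
    then obtain B where B: "\<And>\<xi>. \<xi> \<in> prob_simplex \<Longrightarrow> \<bar>g i \<xi>\<bar> \<le> B"
      by (auto simp: bounded_iff)
    show ?thesis
    proof (rule bdd_LipschitzI[of "L + \<bar>B\<bar>"])
      fix \<xi> \<eta> :: "real^'n" assume *: "\<xi> \<in> prob_simplex" "\<eta> \<in> prob_simplex"
      have "0 \<le> \<bar>B\<bar> * norm (\<xi> - \<eta>)" by simp
      then show "\<bar>g i \<xi> - g i \<eta>\<bar> \<le> (L + \<bar>B\<bar>) * dist \<xi> \<eta>"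
        using L(2)[OF *] unfolding distrib_right dist_norm by linarith
    next
      fix \<xi> :: "real^'n" assume "\<xi> \<in> prob_simplex"
      from B[OF this] show "\<bar>g i \<xi>\<bar> \<le> L + \<bar>B\<bar>" using L(1) by linarith
    qed (use L(1) in simp)
  qed
  have "bdd_Lipschitz {()} prob_simplex (\<lambda>_. replicator_F g i)" for i
    unfolding replicator_F_def
    by (intro bdd_Lipschitz_diff bdd_Lipschitz_sum bdd_Lipschitz_mult bdd_Lipschitz_coord bl) simp
  then have "\<exists>K\<ge>0. \<forall>\<xi>\<in>prob_simplex. \<bar>replicator_F g i \<xi>\<bar> \<le> K \<and>
      (\<forall>\<eta>\<in>prob_simplex. \<bar>replicator_F g i \<xi> - replicator_F g i \<eta>\<bar> \<le> K * norm (\<xi> - \<eta>))" for i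
    by (simp add: bdd_Lipschitz_def dist_norm)
  then have "\<exists>K\<ge>0. \<forall>i. \<forall>\<xi>\<in>prob_simplex. \<bar>replicator_F g i \<xi>\<bar> \<le> K \<and>
      (\<forall>\<eta>\<in>prob_simplex. \<bar>replicator_F g i \<xi> - replicator_F g i \<eta>\<bar> \<le> K * norm (\<xi> - \<eta>))"
  proof (rule finite_uniform_constant)
    fix i C D assume "C \<le> (D::real)" and "\<forall>\<xi>\<in>prob_simplex. \<bar>replicator_F g i \<xi>\<bar> \<le> C \<and>
      (\<forall>\<eta>\<in>prob_simplex. \<bar>replicator_F g i \<xi> - replicator_F g i \<eta>\<bar> \<le> C * norm (\<xi> - \<eta>))"
    then show "\<forall>\<xi>\<in>prob_simplex. \<bar>replicator_F g i \<xi>\<bar> \<le> D \<and>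
      (\<forall>\<eta>\<in>prob_simplex. \<bar>replicator_F g i \<xi> - replicator_F g i \<eta>\<bar> \<le> D * norm (\<xi> - \<eta>))"
      by (blast intro: order.trans mult_right_mono norm_ge_zero)
  qed
  then show thesis using that by blast
qed

section \<open>Convergence\<close>

lemma is_norm_le_norm:
  fixes \<nu> :: "'a::euclidean_space \<Rightarrow> real"
  assumes "is_norm \<nu>"
  shows "\<exists>c>0. \<forall>v. \<nu> v \<le> c * norm v"
proof -
  have nn: "0 \<le> \<nu> v" and z: "\<nu> 0 = 0" and scale: "\<nu> (a *\<^sub>R v) = \<bar>a\<bar> * \<nu> v"
    and tri: "\<nu> (v + w) \<le> \<nu> v + \<nu> w" for a v w
    using assms by (auto simp: is_norm_def)
  have sum: "\<nu> (\<Sum>b\<in>I. F b) \<le> (\<Sum>b\<in>I. \<nu> (F b))" if "finite I" for I and F :: "'a \<Rightarrow> 'a"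
    using that by (induction rule: finite_induct) (auto simp: z intro: order.trans[OF tri])
  have "\<nu> v \<le> (1 + (\<Sum>b\<in>Basis. \<nu> b)) * norm v" for v
  proof -
    have "\<nu> v = \<nu> (\<Sum>b\<in>Basis. (v \<bullet> b) *\<^sub>R b)"
      by (simp add: euclidean_representation)
    also have "\<dots> \<le> (\<Sum>b\<in>Basis. \<bar>v \<bullet> b\<bar> * \<nu> b)"
      using sum[of Basis "\<lambda>b. (v \<bullet> b) *\<^sub>R b"] by (simp add: scale)
    also have "\<dots> \<le> (\<Sum>b\<in>Basis. norm v * \<nu> b)"
      using nn by (intro sum_mono mult_right_mono) (auto simp: Basis_le_norm)
    also have "\<dots> = (\<Sum>b\<in>Basis. \<nu> b) * norm v"
      by (simp add: sum_distrib_left mult.commute)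
    also have "\<dots> \<le> (1 + (\<Sum>b\<in>Basis. \<nu> b)) * norm v"
      by (intro mult_right_mono) auto
    finally show ?thesis .
  qed
  moreover have "0 < 1 + (\<Sum>b\<in>Basis. \<nu> b)"
    using sum_nonneg[of Basis \<nu>] nn by simp
  ultimately show ?thesis by blast
qed

lemma mesh_point_in_interval:
  assumes mesh: "is_mesh T M t" and "n \<le> M"
  shows "t n \<in> {0..T}"
proof -
  have mono: "t m \<le> t n" if "m \<le> n" "n \<le> M" for m n
    using that
  proof (induction rule: dec_induct)
    case (step k)
    then have "t m \<le> t k" "t k < t (Suc k)"
      using mesh by (simp_all add: is_mesh_def)
    then show ?case by simp
  qed simp
  show ?thesis
    using mono[of 0 n] mono[of n M] assms by (simp add: is_mesh_def)
qed

text \<open>A discrete Gronwall estimate: \<open>1 + L h\<^sub>n \<le> exp (L h\<^sub>n)\<close>, and the local errors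
  \<open>C h\<^sub>n\<^sup>3 \<le> C H\<^sup>2 h\<^sub>n\<close> add up to \<open>C H\<^sup>2 t\<^sub>n\<close>.\<close>

lemma accumulated_error:
  assumes mesh: "is_mesh T M t" and L: "0 \<le> L" and C: "0 \<le> C" and e0: "e 0 = 0"
    and H: "\<And>n. n < M \<Longrightarrow> stepsize t n \<le> H"
    and step: "\<And>n. n < M \<Longrightarrow> e (Suc n) \<le> (1 + L * stepsize t n) * e n + C * stepsize t n ^ 3"
    and "n \<le> M"
  shows "e n \<le> C * H\<^sup>2 * t n * exp (L * t n)"
  using \<open>n \<le> M\<close>
proof (induction n)
  case 0
  then show ?case using mesh e0 by (simp add: is_mesh_def)
next
  case (Suc n)
  let ?h = "stepsize t n"
  have n: "n < M" "n \<le> M" using Suc.prems by auto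
  have h: "0 < ?h" using mesh n by (simp add: is_mesh_def stepsize_def)
  have tS: "t (Suc n) = t n + ?h" by (simp add: stepsize_def)
  have t: "0 \<le> t n" "0 \<le> t (Suc n)"
    using mesh_point_in_interval[OF mesh] n Suc.prems by auto
  have E: "1 \<le> exp (L * t (Suc n))" using L t by simp
  have "(1 + L * ?h) * e n \<le> exp (L * ?h) * (C * H\<^sup>2 * t n * exp (L * t n))"
  proof -
    have "(1 + L * ?h) * e n \<le> (1 + L * ?h) * (C * H\<^sup>2 * t n * exp (L * t n))"
      using L h Suc.IH[OF n(2)] by (intro mult_left_mono) auto
    also have "\<dots> \<le> exp (L * ?h) * (C * H\<^sup>2 * t n * exp (L * t n))"
      using C t by (intro mult_right_mono exp_ge_add_one_self) auto
    finally show ?thesis .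
  qed
  also have "\<dots> = C * H\<^sup>2 * t n * exp (L * t (Suc n))"
    by (simp add: tS distrib_left exp_add)
  finally have 1: "(1 + L * ?h) * e n \<le> C * H\<^sup>2 * t n * exp (L * t (Suc n))" .
  have "C * ?h ^ 3 = C * (?h\<^sup>2 * ?h)" by (simp add: power2_eq_square power3_eq_cube)
  also have "\<dots> \<le> C * (H\<^sup>2 * ?h)"
    using C h H[OF n(1)] by (intro mult_left_mono mult_right_mono power_mono) auto
  also have "\<dots> \<le> C * (H\<^sup>2 * ?h) * exp (L * t (Suc n))"
    using C h E mult_left_mono[OF E, of "C * (H\<^sup>2 * ?h)"] by simp
  finally have 2: "C * ?h ^ 3 \<le> C * (H\<^sup>2 * ?h) * exp (L * t (Suc n))" .
  have "e (Suc n) \<le> C * H\<^sup>2 * t n * exp (L * t (Suc n)) + C * (H\<^sup>2 * ?h) * exp (L * t (Suc n))"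
    using step[OF n(1)] 1 2 by linarith
  also have "\<dots> = C * H\<^sup>2 * t (Suc n) * exp (L * t (Suc n))"
    unfolding tS by (simp add: algebra_simps)
  finally show ?case .
qed

theorem theorem4p2:
  fixes f g :: "'n::finite \<Rightarrow> real^'n \<Rightarrow> real"
    and T :: real
    and x :: "real \<Rightarrow> real^'n"
    and \<nu> :: "real^'n \<Rightarrow> real"
  assumes "T > 0"
    and "is_norm \<nu>"
    and "\<forall>i. Ck_simplex_extension 2 (f i) (g i)"
    and "replicator_solution g T x"
    and "x 0 \<in> prob_simplex"
  shows "\<exists>C>0. \<forall>M\<ge>1. \<forall>t. is_mesh T M t \<longrightarrow>
           (MAX n\<in>{0..M}. \<nu> (x (t n) - nri f (stepsize t) (x 0) n))
             \<le> C * (MAX n\<in>{0..<M}. stepsize t n)\<^sup>2"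
proof -
  have "\<forall>i. \<exists>U. open U \<and> prob_simplex \<subseteq> U \<and> Ck_on 2 (g i) U"
    using assms(3) by (auto simp: Ck_simplex_extension_def simp del: Ck_on.simps)
  then obtain V where V: "\<And>i. open (V i)" "\<And>i. prob_simplex \<subseteq> V i" "\<And>i. Ck_on 2 (g i) (V i)"
    by metis
  define U where "U = (\<Inter>i. V i)"
  have U: "open U" "prob_simplex \<subseteq> U"
    using V by (auto simp: U_def)
  have g2: "Ck_on 2 (g i) U" for i
    using V(3) by (rule Ck_on_subset) (auto simp: U_def)
  then have g1: "Ck_on 1 (g i) U" for i
    using Ck_on_SucD[of 1 "g i" U] by (simp add: numeral_2_eq_2 del: Ck_on.simps)
  then have g0: "continuous_on U (g i)" for i
    using Ck_on_SucD[of 0 "g i" U] by simp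
  have fg: "f i \<xi> = g i \<xi>" if "\<xi> \<in> prob_simplex" for i \<xi>
    using assms(3) that by (simp add: Ck_simplex_extension_def)
  have F: "replicator_F f i \<xi> = replicator_F g i \<xi>" if "\<xi> \<in> prob_simplex" for i \<xi>
    using fg[OF that] by (simp add: replicator_F_def)

  have inv: "x t \<in> prob_simplex" if "t \<in> {0..T}" for t
    using assms(4,5) U g0 that by (rule replicator_solution_in_simplex)
  have sol: "replicator_solution f T x"
    using assms(4) inv fg by (simp add: replicator_solution_def)
  have smooth: "Ck_curve 2 {0..T} (\<lambda>t. replicator_F g i (x t))" for i
    using assms(4) _ g2 by (rule replicator_solution_Ck) (use inv U in blast)
  then have smooth: "Ck_curve 2 {0..T} (\<lambda>t. replicator_F f i (x t))" for i
    by (rule Ck_curve_cong) (use F inv in blast)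
  obtain K where K: "0 \<le> K" "\<And>i \<xi>. \<xi> \<in> prob_simplex \<Longrightarrow> \<bar>replicator_F g i \<xi>\<bar> \<le> K"
    "\<And>i \<xi> \<eta>. \<xi> \<in> prob_simplex \<Longrightarrow> \<eta> \<in> prob_simplex \<Longrightarrow>
      \<bar>replicator_F g i \<xi> - replicator_F g i \<eta>\<bar> \<le> K * norm (\<xi> - \<eta>)"
    by (rule replicator_F_bounded_Lipschitz[of g U, OF g1 U(2)]) blast
  have Kf: "\<bar>replicator_F f i \<xi>\<bar> \<le> K" if "\<xi> \<in> prob_simplex" for i \<xi>
    using K(2)[OF that] F[OF that] by simp
  have Lf: "\<bar>replicator_F f i \<xi> - replicator_F f i \<eta>\<bar> \<le> K * norm (\<xi> - \<eta>)"
    if "\<xi> \<in> prob_simplex" "\<eta> \<in> prob_simplex" for i \<xi> \<eta>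
    using K(3)[OF that] F[OF that(1)] F[OF that(2)] by simp

  obtain C where C: "0 \<le> C" "\<And>t h. 0 \<le> t \<Longrightarrow> 0 \<le> h \<Longrightarrow> t + h \<le> T \<Longrightarrow>
      norm (x (t + h) - nri_step f h (x t)) \<le> C * h ^ 3"
    using nri_local_error[OF sol inv smooth K(1) Kf K(1) Lf] by blast
  obtain S where S: "0 \<le> S" "\<And>h \<xi> \<eta>. h \<in> {0..T} \<Longrightarrow> \<xi> \<in> prob_simplex \<Longrightarrow> \<eta> \<in> prob_simplex \<Longrightarrow>
      norm (nri_step f h \<xi> - nri_step f h \<eta>) \<le> (1 + S * h) * norm (\<xi> - \<eta>)"
    using nri_step_stable[OF K(1) Kf K(1) Lf, of T] by blast
  obtain c where c: "0 < c" "\<And>v. \<nu> v \<le> c * norm v"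
    using is_norm_le_norm[OF assms(2)] by blast

  have bound: "\<nu> (x (t n) - nri f (stepsize t) (x 0) n)
      \<le> (c * (C * T * exp (S * T)) + 1) * (MAX n\<in>{0..<M}. stepsize t n)\<^sup>2"
    if mesh: "is_mesh T M t" and n: "n \<le> M" for M t n
  proof -
    define H where "H = (MAX n\<in>{0..<M}. stepsize t n)"
    define X where "X n = nri f (stepsize t) (x 0) n" for n
    have X: "X n \<in> prob_simplex" for n
      unfolding X_def using assms(5) by (rule nri_in_simplex)
    have tn: "t n \<in> {0..T}" if "n \<le> M" for n
      using mesh that by (rule mesh_point_in_interval)
    have "norm (x (t n) - X n) \<le> C * H\<^sup>2 * t n * exp (S * t n)"
    proof (rule accumulated_error[OF mesh S(1) C(1) _ _ _ n])
      show "norm (x (t 0) - X 0) = 0"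
        using mesh by (simp add: is_mesh_def X_def)
      fix n assume n: "n < M"
      then show "stepsize t n \<le> H"
        unfolding H_def by (intro Max_ge) auto
      let ?h = "stepsize t n"
      have tS: "t (Suc n) = t n + ?h" by (simp add: stepsize_def)
      have h: "0 \<le> ?h" "?h \<in> {0..T}" "0 \<le> t n" "t n + ?h \<le> T" "t n \<in> {0..T}"
        using mesh n tn[of n] tn[of "Suc n"] by (auto simp: is_mesh_def stepsize_def less_imp_le)
      have "norm (x (t (Suc n)) - X (Suc n)) \<le> norm (x (t n + ?h) - nri_step f ?h (x (t n)))
          + norm (nri_step f ?h (x (t n)) - nri_step f ?h (X n))"
        using norm_triangle_ineq[of "x (t n + ?h) - nri_step f ?h (x (t n))"
            "nri_step f ?h (x (t n)) - nri_step f ?h (X n)"]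
        unfolding tS by (simp add: X_def)
      also have "\<dots> \<le> C * ?h ^ 3 + (1 + S * ?h) * norm (x (t n) - X n)"
        using h inv X by (intro add_mono C(2) S(2)) auto
      finally show "norm (x (t (Suc n)) - X (Suc n))
          \<le> (1 + S * ?h) * norm (x (t n) - X n) + C * ?h ^ 3" by simp
    qed
    also have "\<dots> \<le> C * H\<^sup>2 * T * exp (S * T)"
      using C(1) S(1) tn[OF n] by (intro mult_mono) (auto intro: mult_left_mono)
    finally have "c * norm (x (t n) - X n) \<le> c * (C * H\<^sup>2 * T * exp (S * T))"
      using c(1) by (intro mult_left_mono) auto
    also have "\<dots> \<le> (c * (C * T * exp (S * T)) + 1) * H\<^sup>2"
      by (simp add: algebra_simps)
    finally show ?thesis
      using c(2)[of "x (t n) - X n"] by (simp add: X_def H_def)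
  qed
  show ?thesis
  proof (intro exI[of _ "c * (C * T * exp (S * T)) + 1"] conjI allI impI)
    show "0 < c * (C * T * exp (S * T)) + 1"
      using c(1) C(1) assms(1) by (intro add_nonneg_pos mult_nonneg_nonneg) auto
  next
    fix M t assume "is_mesh T M t"
    then show "(MAX n\<in>{0..M}. \<nu> (x (t n) - nri f (stepsize t) (x 0) n))
        \<le> (c * (C * T * exp (S * T)) + 1) * (MAX n\<in>{0..<M}. stepsize t n)\<^sup>2"
      using bound by (intro Max.boundedI) auto
  qed
qed

end
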